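(* Fix an integer $m \geq 2$. Then for all sufficiently large $n$ the following holds. If $G$ is a properly edge-coloured graph on $n$ vertices with at least $n (\log n)^{60}$ edges, then $G$ contains a rainbow subdivision of $K_m$ in which each edge of $K_m$ is subdivided at most $(\log n)^{6}$ times.
   Context: Logarithms are in base 2. A proper edge-colouring assigns colours to edges so that edges sharing a vertex receive distinct colours. A subgraph is rainbow if all its edges have distinct colours. A subdivision of $K_m$ is a graph obtained from $K_m$ by replacing each edge by a path between its endpoints, these paths being internally vertex-disjoint; an edge is subdivided at most $t$ times if the corresponding path has at most $t$ internal vertices. *)

theory Defs
  imports Complex_Main
begin

definition simple_graph :: "'a set \<Rightarrow> 'a set set \<Rightarrow> bool" where
  "simple_graph V E \<longleftrightarrow> finite V \<and> (\<forall>e\<in>E. e \<subseteq> V \<and> card e = 2)"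

definition subgraph_of :: "'a set \<Rightarrow> 'a set set \<Rightarrow> 'a set \<Rightarrow> 'a set set \<Rightarrow> bool" where
  "subgraph_of V' E' V E \<longleftrightarrow> simple_graph V' E' \<and> V' \<subseteq> V \<and> E' \<subseteq> E"

definition complete_edges :: "'a set \<Rightarrow> 'a set set" where
  "complete_edges W = {e. e \<subseteq> W \<and> card e = 2}"

definition proper_edge_colouring :: "'a set set \<Rightarrow> ('a set \<Rightarrow> 'c) \<Rightarrow> bool" where
  "proper_edge_colouring E c \<longleftrightarrow>
     (\<forall>e\<in>E. \<forall>f\<in>E. e \<noteq> f \<and> e \<inter> f \<noteq> {} \<longrightarrow> c e \<noteq> c f)"

definition rainbow :: "('a set \<Rightarrow> 'c) \<Rightarrow> 'a set set \<Rightarrow> bool" where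
  "rainbow c E \<longleftrightarrow> inj_on c E"

text \<open>A path is given by the list of its vertices, in order.\<close>

definition is_path :: "'a list \<Rightarrow> bool" where
  "is_path p \<longleftrightarrow> p \<noteq> [] \<and> distinct p"

definition path_edges :: "'a list \<Rightarrow> 'a set set" where
  "path_edges p = {{p ! i, p ! Suc i} | i. Suc i < length p}"

definition internal_vertices :: "'a list \<Rightarrow> 'a set" where
  "internal_vertices p = set (butlast (tl p))"

text \<open>
  The graph \<open>(V, E)\<close> is a subdivision of the simple graph \<open>(W, F)\<close> in which each edge is
  subdivided at most \<open>t\<close> times: \<open>\<phi>\<close> places the vertices of \<open>W\<close> in \<open>V\<close>, and the edge \<open>e\<close> is
  replaced by the path \<open>P e\<close>. Edges are unordered, so the direction in which \<open>P e\<close> is listed is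
  left open. The replacing paths run through new vertices only, hence the
  condition that internal vertices avoid \<open>\<phi> ` W\<close>. The path \<open>P e\<close> may be a single edge.
\<close>

definition subdivision_at_most ::
  "real \<Rightarrow> 'b set \<Rightarrow> 'b set set \<Rightarrow> 'a set \<Rightarrow> 'a set set \<Rightarrow> bool" where
  "subdivision_at_most t W F V E \<longleftrightarrow>
     (\<exists>(\<phi> :: 'b \<Rightarrow> 'a) (P :: 'b set \<Rightarrow> 'a list).
        inj_on \<phi> W \<and>
        (\<forall>e\<in>F. is_path (P e) \<and> {hd (P e), last (P e)} = \<phi> ` e \<and>
           internal_vertices (P e) \<inter> \<phi> ` W = {} \<and>
           real (card (internal_vertices (P e))) \<le> t) \<and>
        (\<forall>e\<in>F. \<forall>f\<in>F. e \<noteq> f \<longrightarrow> internal_vertices (P e) \<inter> internal_vertices (P f) = {}) \<and>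
        V = \<phi> ` W \<union> (\<Union>e\<in>F. set (P e)) \<and>
        E = (\<Union>e\<in>F. path_edges (P e)))"

end

(*
Idea. Deleting sparse cuts and vertices of small degree as long as possible leaves a subgraph with
conductance at least of order 1/log n and minimum degree d of order (log n)^60; a set minimal with
respect to the potential e(U) (2 log e(G) - log e(U)) - D |U| achieves this in one step. By
Cheeger's inequality the lazy random walk there mixes pointwise after k = O((log n)^3) steps.
Since the colouring is proper, a step from a given vertex has a prescribed colour with probability
at most 1/d. Hence, even conditioned on its end point, a walk of length 3k repeats a colour, uses
one of r forbidden colours or visits one of r forbidden vertices with probability
O(k (k + r) / d) < 1: the events at time i decouple from one of the end points by mixing,
directly or after reversing the walk. So any two vertices are joined by short rainbow paths
avoiding all colours and vertices used before, and K_m is embedded greedily.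
*)
theory Submission
  imports Defs "HOL-Analysis.Convex"
begin

subsection \<open>Mixing of the lazy random walk on a weighted graph\<close>

text \<open>The walk is never actually conditioned on its end point. Every estimate concerns the
  probability that the walk from x ends at y and some event occurs, measured against the stationary
  weight of y. Mixing gives at least half that weight to ending at y, and costs at most a factor 2
  each time it decouples an event, so a union bound over small events suffices. The factor 3 in the
  length comes from colour repetitions: two marked steps cut the walk into three stretches, one of
  which must be long enough to mix. A union over colours would seem to cost the number of colours.
  It does not, since every move has just one colour: one of the two marked steps is charged 1/d for
  a fixed colour, and the sum over colours at the other is at most a full step. Forbidden vertices
  meet a different obstacle. A lazy walk inside the forbidden set stays there with probability at
  least 1/2, so being there cannot be charged to a single step. Entering the set can, and entering
  is not symmetric: reversal turns it into leaving. A good walk may still stand still or revisit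
  vertices; erasing its loops gives the path.\<close>

lemma exists_switch:
  assumes "P a" "\<not> P b" "a \<le> (b :: nat)"
  obtains i where "a \<le> i" "i < b" "P i" "\<not> P (Suc i)"
proof -
  have "P n" if "n \<ge> a" "n \<le> b" "\<forall>i. a \<le> i \<and> i < b \<and> P i \<longrightarrow> P (Suc i)" for n
    using that by (induction n rule: dec_induct) (use assms in auto)
  with assms that show ?thesis
    by blast
qed

lemma weighted_Cauchy_Schwarz:
  fixes w a b :: "'i \<Rightarrow> real"
  assumes "\<And>i. i \<in> I \<Longrightarrow> w i \<ge> 0"
  shows "(\<Sum>i\<in>I. w i * a i * b i)\<^sup>2 \<le> (\<Sum>i\<in>I. w i * (a i)\<^sup>2) * (\<Sum>i\<in>I. w i * (b i)\<^sup>2)"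
proof -
  have "(\<Sum>i\<in>I. (sqrt (w i) * a i) * (sqrt (w i) * b i))\<^sup>2 \<le>
      (\<Sum>i\<in>I. (sqrt (w i) * a i)\<^sup>2) * (\<Sum>i\<in>I. (sqrt (w i) * b i)\<^sup>2)"
    by (rule Cauchy_Schwarz_ineq_sum)
  moreover have "(\<Sum>i\<in>I. (sqrt (w i) * a i) * (sqrt (w i) * b i)) = (\<Sum>i\<in>I. w i * a i * b i)"
    by (rule sum.cong) (use assms in \<open>auto simp: algebra_simps\<close>)
  moreover have "(\<Sum>i\<in>I. (sqrt (w i) * a i)\<^sup>2) = (\<Sum>i\<in>I. w i * (a i)\<^sup>2)" for a
    by (rule sum.cong) (use assms in \<open>auto simp: power_mult_distrib\<close>)
  ultimately show ?thesis
    by simp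
qed

section \<open>The lazy walk as a self-adjoint averaging operator\<close>

locale weighted_graph =
  fixes U :: "'a set" and A :: "'a \<Rightarrow> 'a \<Rightarrow> real"
  assumes finite_U [simp]: "finite U"
    and A_sym: "A x y = A y x"
    and A_nonneg: "A x y \<ge> 0"
    and sum_A_pos: "x \<in> U \<Longrightarrow> (\<Sum>y\<in>U. A x y) > 0"
begin

definition deg :: "'a \<Rightarrow> real" where
  "deg x = (\<Sum>y\<in>U. A x y)"

definition vol :: "'a set \<Rightarrow> real" where
  "vol S = sum deg S"

text \<open>The weight \<open>deg\<close> is the reversible measure of the walk, left unnormalised
  with total mass \<open>vol U\<close>. With respect to it \<open>step\<close> is
  self-adjoint.\<close>

definition inn :: "('a \<Rightarrow> real) \<Rightarrow> ('a \<Rightarrow> real) \<Rightarrow> real" where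
  "inn f g = (\<Sum>x\<in>U. deg x * f x * g x)"

text \<open>A Dirichlet form over ordered pairs: each edge counts twice.\<close>

definition energy :: "('a \<Rightarrow> real) \<Rightarrow> real" where
  "energy f = (\<Sum>x\<in>U. \<Sum>y\<in>U. A x y * (f x - f y)\<^sup>2)"

definition ker :: "'a \<Rightarrow> 'a \<Rightarrow> real" where
  "ker x y = of_bool (x = y) / 2 + A x y / (2 * deg x)"

text \<open>The walk acts on functions rather than on distributions, so \<open>(step ^^ n)\<close>
  applied to the indicator of y and evaluated at x is the n-step transition probability from x to
  y.\<close>

definition step :: "('a \<Rightarrow> real) \<Rightarrow> 'a \<Rightarrow> real" where
  "step f x = (\<Sum>y\<in>U. ker x y * f y)"

definition conductance_ge :: "real \<Rightarrow> bool" where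
  "conductance_ge \<phi> \<longleftrightarrow>
     (\<forall>S\<subseteq>U. 2 * vol S \<le> vol U \<longrightarrow> \<phi> * vol S \<le> (\<Sum>x\<in>S. \<Sum>y\<in>U - S. A x y))"

lemma deg_pos: "x \<in> U \<Longrightarrow> deg x > 0"
  using sum_A_pos by (simp add: deg_def)

lemma deg_nonneg [simp]: "deg x \<ge> 0"
  by (simp add: deg_def sum_nonneg A_nonneg)

lemma vol_nonneg [simp]: "vol S \<ge> 0"
  by (simp add: vol_def sum_nonneg)

lemma vol_pos: "x \<in> U \<Longrightarrow> vol U > 0"
  unfolding vol_def by (rule sum_pos2[where i = x]) (auto simp: deg_pos)

lemma ker_nonneg [simp]: "ker x y \<ge> 0"
  by (simp add: ker_def A_nonneg)

lemma sum_point: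
  assumes "y \<in> U"
  shows "(\<Sum>z\<in>U. g z * of_bool (z = y)) = (g y :: real)"
proof -
  have "(\<Sum>z\<in>U. g z * of_bool (z = y)) = (\<Sum>z\<in>U. if z = y then g z else 0)"
    by (intro sum.cong) auto
  with assms show ?thesis
    by simp
qed

lemma step_eq:
  assumes "x \<in> U"
  shows "step f x = f x / 2 + (\<Sum>y\<in>U. A x y * f y) / (2 * deg x)"
proof -
  have "step f x = (\<Sum>y\<in>U. f y / 2 * of_bool (y = x) + A x y * f y / (2 * deg x))"
    unfolding step_def by (intro sum.cong) (auto simp: ker_def algebra_simps)
  then show ?thesis
    unfolding sum.distrib sum_point[OF assms] by (simp add: sum_divide_distrib)
qed

lemma step_cong: "(\<And>y. y \<in> U \<Longrightarrow> f y = g y) \<Longrightarrow> step f x = step g x"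
  by (simp add: step_def)

lemma step_const: "x \<in> U \<Longrightarrow> step (\<lambda>_. a) x = a"
  using deg_pos[of x] by (simp add: step_eq sum_distrib_right[symmetric] deg_def[symmetric])

lemma step_diff: "step (\<lambda>x. f x - g x) = (\<lambda>x. step f x - step g x)"
  by (simp add: step_def fun_eq_iff algebra_simps sum_subtractf)

lemma step_sum: "step (\<lambda>x. \<Sum>i\<in>I. f i x) = (\<lambda>x. \<Sum>i\<in>I. step (f i) x)"
  unfolding step_def sum_distrib_left by (rule ext, rule sum.swap)

lemma step_cmult: "step (\<lambda>x. a * f x) = (\<lambda>x. a * step f x)"
  by (simp add: step_def fun_eq_iff sum_distrib_left algebra_simps)

lemma step_mono: "(\<And>y. y \<in> U \<Longrightarrow> f y \<le> g y) \<Longrightarrow> step f x \<le> step g x"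
  unfolding step_def by (intro sum_mono mult_left_mono) auto

lemma steps_cong: "(\<And>y. y \<in> U \<Longrightarrow> f y = g y) \<Longrightarrow> x \<in> U \<Longrightarrow> (step ^^ n) f x = (step ^^ n) g x"
  by (induction n arbitrary: x) (auto intro!: step_cong)

lemma steps_const: "x \<in> U \<Longrightarrow> (step ^^ n) (\<lambda>_. a) x = a"
proof (induction n arbitrary: x)
  case (Suc n)
  then have "step ((step ^^ n) (\<lambda>_. a)) x = step (\<lambda>_. a) x"
    by (intro step_cong)
  with Suc.prems show ?case
    by (simp add: step_const)
qed simp

lemma steps_diff: "(step ^^ n) (\<lambda>x. f x - g x) = (\<lambda>x. (step ^^ n) f x - (step ^^ n) g x)"
  by (induction n) (auto simp: step_diff)

lemma steps_sum: "(step ^^ n) (\<lambda>x. \<Sum>i\<in>I. f i x) = (\<lambda>x. \<Sum>i\<in>I. (step ^^ n) (f i) x)"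
  by (induction n) (auto simp: step_sum)

lemma steps_cmult: "(step ^^ n) (\<lambda>x. a * f x) = (\<lambda>x. a * (step ^^ n) f x)"
  by (induction n) (auto simp: step_cmult)

lemma steps_mono: "(\<And>y. y \<in> U \<Longrightarrow> f y \<le> g y) \<Longrightarrow> x \<in> U \<Longrightarrow> (step ^^ n) f x \<le> (step ^^ n) g x"
  by (induction n arbitrary: x) (auto intro!: step_mono)

lemma inn_step:
  "inn f (step g) = inn f g / 2 + (\<Sum>x\<in>U. \<Sum>y\<in>U. A x y * f x * g y) / 2"
proof -
  have "deg x * f x * step g x = deg x * f x * g x / 2 + (\<Sum>y\<in>U. A x y * f x * g y) / 2"
    if "x \<in> U" for x
    using deg_pos[OF that] by (simp add: step_eq that field_simps sum_distrib_left)
  then have "inn f (step g) = (\<Sum>x\<in>U. deg x * f x * g x / 2 + (\<Sum>y\<in>U. A x y * f x * g y) / 2)"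
    unfolding inn_def by (intro sum.cong) auto
  then show ?thesis
    by (simp add: sum.distrib inn_def sum_divide_distrib)
qed

lemma inn_commute: "inn f g = inn g f"
  by (simp add: inn_def algebra_simps)

lemma inn_step_adjoint: "inn f (step g) = inn (step f) g"
proof -
  have "(\<Sum>x\<in>U. \<Sum>y\<in>U. A x y * f x * g y) = (\<Sum>x\<in>U. \<Sum>y\<in>U. A x y * g x * f y)"
    by (subst sum.swap) (simp add: A_sym[of y x for x y] algebra_simps)
  then show ?thesis
    by (simp add: inn_step inn_commute[of "step f"] inn_commute[of g f])
qed

lemma inn_steps_adjoint: "inn f ((step ^^ n) g) = inn ((step ^^ n) f) g"
proof (induction n arbitrary: f)
  case (Suc n)
  have "inn f ((step ^^ Suc n) g) = inn ((step ^^ n) (step f)) g"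
    by (simp add: inn_step_adjoint Suc.IH)
  then show ?case
    by (simp only: funpow_Suc_right comp_apply)
qed simp

lemma inn_cong: "(\<And>x. x \<in> U \<Longrightarrow> f x = f' x) \<Longrightarrow> (\<And>x. x \<in> U \<Longrightarrow> g x = g' x) \<Longrightarrow> inn f g = inn f' g'"
  by (auto simp: inn_def intro!: sum.cong)

text \<open>Stationarity of \<open>deg\<close>: constants are fixed by the self-adjoint
  \<open>step\<close>. This keeps mean-zero functions mean-zero and lets unrestricted stretches of a
  walk disappear once the start is averaged out.\<close>

lemma inn_one_steps: "inn (\<lambda>_. 1) ((step ^^ n) g) = inn (\<lambda>_. 1) g"
  by (simp add: inn_steps_adjoint) (rule inn_cong, auto simp: steps_const)

section \<open>Cheeger's inequality\<close>

lemma coarea: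
  assumes "conductance_ge \<phi>" "\<And>x. x \<in> U \<Longrightarrow> h x \<ge> 0" "2 * vol {x\<in>U. h x > 0} \<le> vol U"
  shows "2 * \<phi> * (\<Sum>x\<in>U. deg x * h x) \<le> (\<Sum>x\<in>U. \<Sum>y\<in>U. A x y * \<bar>h x - h y\<bar>)"
  using assms(2,3)
proof (induction "card {x\<in>U. h x > 0}" arbitrary: h rule: less_induct)
  case less
  define S where "S = {x\<in>U. h x > 0}"
  have S: "finite S" "S \<subseteq> U"
    by (auto simp: S_def)
  show ?case
  proof (cases "S = {}")
    case True
    then have "h x = 0" if "x \<in> U" for x
      using that less.prems(1)[of x] by (force simp: S_def)
    then show ?thesis
      by (simp)
  next
    case False
    \<comment> \<open>The induction peels off the lowest positive level: h is t times the indicator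
      of its support plus a function \<open>h'\<close> whose support is strictly smaller, hence
      still of at most half the volume.\<close>
    define t where "t = Min (h ` S)"
    have t: "t \<in> h ` S" "\<And>x. x \<in> S \<Longrightarrow> t \<le> h x"
      using S False by (auto simp: t_def)
    then have "t > 0"
      by (auto simp: S_def)
    define h' where "h' x = (if x \<in> S then h x - t else 0)" for x
    have h'0: "h' x \<ge> 0" for x
      using t by (auto simp: h'_def)
    have h'_out: "h' x = 0" if "x \<notin> S" for x
      using that by (simp add: h'_def)
    have h_eq: "h x = t * of_bool (x \<in> S) + h' x" if "x \<in> U" for x
      using that less.prems(1)[of x] by (auto simp: h'_def S_def)
    \<comment> \<open>All values on S are at least t, so peeling leaves differences within S
      unchanged and lowers each difference across the cut by exactly t.\<close>
    have diff: "\<bar>h x - h y\<bar> = t * of_bool (x \<in> S \<and> y \<notin> S) + t * of_bool (y \<in> S \<and> x \<notin> S)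
        + \<bar>h' x - h' y\<bar>" if "x \<in> U" "y \<in> U" for x y
      using \<open>t > 0\<close> h'0[of x] h'0[of y] h'_out[of x] h'_out[of y] that
      by (cases "x \<in> S"; cases "y \<in> S") (simp_all add: h_eq)
    have sub: "{x\<in>U. h' x > 0} \<subset> S"
    proof -
      obtain x where "x \<in> S" "h x = t"
        using t by auto
      then show ?thesis
        using S by (auto simp: h'_def split: if_splits)
    qed
    have "2 * vol {x\<in>U. h' x > 0} \<le> 2 * vol S"
      unfolding vol_def using sub S by (auto intro!: sum_mono2)
    then have IH: "2 * \<phi> * (\<Sum>x\<in>U. deg x * h' x) \<le> (\<Sum>x\<in>U. \<Sum>y\<in>U. A x y * \<bar>h' x - h' y\<bar>)"
      using less.prems(2) h'0 psubset_card_mono[OF S(1) sub]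
      by (intro less.hyps) (auto simp: S_def)
    have cut: "(\<Sum>x\<in>U. \<Sum>y\<in>U. A x y * of_bool (x \<in> S \<and> y \<notin> S)) = (\<Sum>x\<in>S. \<Sum>y\<in>U - S. A x y)"
    proof -
      have "(\<Sum>x\<in>S. \<Sum>y\<in>U - S. A x y) = (\<Sum>x\<in>S. \<Sum>y\<in>U. A x y * of_bool (x \<in> S \<and> y \<notin> S))"
        by (intro sum.cong[OF refl] sum.mono_neutral_cong_left) auto
      also have "\<dots> = (\<Sum>x\<in>U. \<Sum>y\<in>U. A x y * of_bool (x \<in> S \<and> y \<notin> S))"
        using S by (intro sum.mono_neutral_left) auto
      finally show ?thesis ..
    qed
    \<comment> \<open>Ordered pairs meet every crossing edge in both directions; this is the source
      of the factor 2 in the claim.\<close>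
    have cut': "(\<Sum>x\<in>U. \<Sum>y\<in>U. A x y * of_bool (y \<in> S \<and> x \<notin> S)) = (\<Sum>x\<in>S. \<Sum>y\<in>U - S. A x y)"
      unfolding cut[symmetric] by (subst sum.swap) (simp add: A_sym[of y x for x y])
    have "(\<Sum>x\<in>U. deg x * h x) = (\<Sum>x\<in>U. t * (deg x * of_bool (x \<in> S)) + deg x * h' x)"
      by (intro sum.cong) (auto simp: h_eq algebra_simps)
    also have "\<dots> = t * (\<Sum>x\<in>U. deg x * of_bool (x \<in> S)) + (\<Sum>x\<in>U. deg x * h' x)"
      by (simp only: sum.distrib sum_distrib_left)
    also have "(\<Sum>x\<in>U. deg x * of_bool (x \<in> S)) = vol S"
      unfolding vol_def using S by (intro sum.mono_neutral_cong_right) auto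
    finally have L: "(\<Sum>x\<in>U. deg x * h x) = t * vol S + (\<Sum>x\<in>U. deg x * h' x)" .
    have "(\<Sum>x\<in>U. \<Sum>y\<in>U. A x y * \<bar>h x - h y\<bar>) =
       (\<Sum>x\<in>U. \<Sum>y\<in>U. t * (A x y * of_bool (x \<in> S \<and> y \<notin> S)) + t * (A x y * of_bool (y \<in> S \<and> x \<notin> S))
         + A x y * \<bar>h' x - h' y\<bar>)"
      by (intro sum.cong refl) (simp add: diff algebra_simps)
    also have "\<dots> = t * (\<Sum>x\<in>U. \<Sum>y\<in>U. A x y * of_bool (x \<in> S \<and> y \<notin> S))
        + t * (\<Sum>x\<in>U. \<Sum>y\<in>U. A x y * of_bool (y \<in> S \<and> x \<notin> S)) + (\<Sum>x\<in>U. \<Sum>y\<in>U. A x y * \<bar>h' x - h' y\<bar>)"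
      by (simp only: sum.distrib sum_distrib_left)
    finally have R: "(\<Sum>x\<in>U. \<Sum>y\<in>U. A x y * \<bar>h x - h y\<bar>) = 
       2 * t * (\<Sum>x\<in>S. \<Sum>y\<in>U - S. A x y) + (\<Sum>x\<in>U. \<Sum>y\<in>U. A x y * \<bar>h' x - h' y\<bar>)"
      by (simp only: cut cut')
    have "\<phi> * vol S \<le> (\<Sum>x\<in>S. \<Sum>y\<in>U - S. A x y)"
      using assms(1) S less.prems(2) by (auto simp: conductance_ge_def S_def)
    then have "2 * t * (\<phi> * vol S) \<le> 2 * t * (\<Sum>x\<in>S. \<Sum>y\<in>U - S. A x y)"
      using \<open>t > 0\<close> by (intro mult_left_mono) auto
    with IH show ?thesis
      unfolding L R by (simp add: algebra_simps)
  qed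
qed

lemma sum_A_left: "(\<Sum>x\<in>U. \<Sum>y\<in>U. A x y * f x) = (\<Sum>x\<in>U. deg x * f x)"
  by (simp add: deg_def sum_distrib_right)

lemma sum_A_right: "(\<Sum>x\<in>U. \<Sum>y\<in>U. A x y * f y) = (\<Sum>x\<in>U. deg x * f x)"
  by (subst sum.swap, subst A_sym) (rule sum_A_left)

text \<open>The coarea bound for the square of g, with the difference of squares factored and
  Cauchy-Schwarz applied. The factor with \<open>g x + g y\<close> contributes at most 4 times the
  norm, which cancels against the 4 from squaring.\<close>

lemma cheeger_nonneg:
  assumes "conductance_ge \<phi>" "\<phi> \<ge> 0" "\<And>x. x \<in> U \<Longrightarrow> g x \<ge> 0" "2 * vol {x\<in>U. g x > 0} \<le> vol U"
  shows "\<phi>\<^sup>2 * inn g g \<le> energy g"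
proof -
  define G where "G = inn g g"
  have G0: "G \<ge> 0"
    unfolding G_def inn_def by (intro sum_nonneg) (simp add: mult.assoc)
  have G: "G = (\<Sum>x\<in>U. deg x * (g x)\<^sup>2)"
    by (simp add: G_def inn_def power2_eq_square mult.assoc)
  have supp: "{x\<in>U. (g x)\<^sup>2 > 0} = {x\<in>U. g x > 0}"
    using assms(3) by force
  have abs_eq: "\<bar>(g x)\<^sup>2 - (g y)\<^sup>2\<bar> = \<bar>g x - g y\<bar> * (g x + g y)" if "x \<in> U" "y \<in> U" for x y
    using assms(3)[OF that(1)] assms(3)[OF that(2)]
    by (simp add: power2_eq_square square_diff_square_factored abs_mult)
  have "2 * \<phi> * G \<le> (\<Sum>x\<in>U. \<Sum>y\<in>U. A x y * \<bar>(g x)\<^sup>2 - (g y)\<^sup>2\<bar>)"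
    unfolding G using assms supp by (intro coarea) auto
  also have "\<dots> = (\<Sum>x\<in>U. \<Sum>y\<in>U. A x y * \<bar>g x - g y\<bar> * (g x + g y))"
    by (intro sum.cong refl) (simp add: abs_eq)
  also have "\<dots> = (\<Sum>(x,y)\<in>U\<times>U. A x y * \<bar>g x - g y\<bar> * (g x + g y))"
    by (simp add: sum.cartesian_product)
  finally have "(2 * \<phi> * G)\<^sup>2 \<le> (\<Sum>(x,y)\<in>U\<times>U. A x y * \<bar>g x - g y\<bar> * (g x + g y))\<^sup>2"
    using assms(2) G0 by (intro power_mono) auto
  also have "\<dots> \<le> (\<Sum>(x,y)\<in>U\<times>U. A x y * \<bar>g x - g y\<bar>\<^sup>2) * (\<Sum>(x,y)\<in>U\<times>U. A x y * (g x + g y)\<^sup>2)"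
    using weighted_Cauchy_Schwarz[of "U \<times> U" "\<lambda>(x,y). A x y" "\<lambda>(x,y). \<bar>g x - g y\<bar>" "\<lambda>(x,y). g x + g y"]
    by (auto simp: case_prod_unfold A_nonneg)
  also have "(\<Sum>(x,y)\<in>U\<times>U. A x y * \<bar>g x - g y\<bar>\<^sup>2) = energy g"
    by (simp add: energy_def sum.cartesian_product)
  also have "(\<Sum>(x,y)\<in>U\<times>U. A x y * (g x + g y)\<^sup>2) \<le> (\<Sum>(x,y)\<in>U\<times>U. 2 * (A x y * (g x)\<^sup>2) + 2 * (A x y * (g y)\<^sup>2))"
  proof (intro sum_mono, clarify)
    fix x y
    have "(g x + g y)\<^sup>2 \<le> 2 * (g x)\<^sup>2 + 2 * (g y)\<^sup>2"
      using sum_squares_bound[of "g x" "g y"] by (simp add: power2_sum)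
    from mult_left_mono[OF this A_nonneg[of x y]]
    show "A x y * (g x + g y)\<^sup>2 \<le> 2 * (A x y * (g x)\<^sup>2) + 2 * (A x y * (g y)\<^sup>2)"
      by (simp add: algebra_simps)
  qed
  also have "\<dots> = 2 * (\<Sum>x\<in>U. \<Sum>y\<in>U. A x y * (g x)\<^sup>2) + 2 * (\<Sum>x\<in>U. \<Sum>y\<in>U. A x y * (g y)\<^sup>2)"
    by (simp only: sum.cartesian_product[symmetric] sum.distrib sum_distrib_left)
  also have "\<dots> = 4 * G"
    by (simp add: sum_A_left[of "\<lambda>x. (g x)\<^sup>2"] sum_A_right[of "\<lambda>x. (g x)\<^sup>2"] G)
  finally have *: "(2 * \<phi> * G)\<^sup>2 \<le> energy g * (4 * G)"
    by (auto simp: mult_left_mono energy_def sum_nonneg A_nonneg)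
  have e0: "energy g \<ge> 0"
    by (auto simp: energy_def sum_nonneg A_nonneg)
  show ?thesis
  proof (cases "G = 0")
    case False
    with G0 have "G > 0" by simp
    with * show ?thesis
      by (simp add: power_mult_distrib power2_eq_square G_def[symmetric])
  qed (use e0 in \<open>simp add: G_def\<close>)
qed

text \<open>The median is the smallest value of f above which at most half the volume lies; by
  minimality, the next smaller value has more than half the volume above it.\<close>

lemma exists_median:
  obtains m :: real where "2 * vol {x\<in>U. f x > m} \<le> vol U" "2 * vol {x\<in>U. f x < m} \<le> vol U"
proof (cases "U = {}")
  case True
  then have "{x\<in>U. Q x} = {}" for Q
    by auto
  note empty = this
  show ?thesis
    by (intro that[of 0]) (simp_all only: empty, simp_all add: vol_def[of "{}"])
next
  case False
  define M where "M = {m \<in> f ` U. 2 * vol {x\<in>U. f x > m} \<le> vol U}"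
  have "Max (f ` U) \<in> M"
  proof -
    have "{x\<in>U. f x > Max (f ` U)} = {}"
      by (auto simp: not_less)
    then show ?thesis
      using False unfolding M_def by (simp only: mem_Collect_eq) (auto simp: vol_def sum_nonneg)
  qed
  then have M: "M \<noteq> {}" "finite M"
    by (auto simp: M_def)
  define m where "m = Min M"
  have m: "m \<in> M"
    using M by (simp add: m_def)
  have "2 * vol {x\<in>U. f x < m} \<le> vol U"
  proof (cases "{x\<in>U. f x < m} = {}")
    case True
    then show ?thesis
      by (simp only: True) (simp add: vol_def sum_nonneg)
  next
    case False
    define B where "B = {x\<in>U. f x < m}"
    define m' where "m' = Max (f ` B)"
    have "m' \<in> f ` B"
      unfolding m'_def using False by (intro Max_in) (auto simp: B_def)
    then have "m' < m" "m' \<in> f ` U"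
      by (auto simp: B_def)
    then have "m' \<notin> M"
      using M by (auto simp: m_def)
    with \<open>m' \<in> f ` U\<close> have "2 * vol {x\<in>U. f x > m'} > vol U"
      by (auto simp: M_def)
    moreover have "{x\<in>U. f x > m'} = U - B"
    proof -
      have "f x \<le> m'" if "x \<in> B" for x
        using that by (auto simp: m'_def B_def)
      then show ?thesis
        using \<open>m' < m\<close> by (force simp: B_def)
    qed
    moreover have "vol (U - B) = vol U - vol B"
      unfolding vol_def by (rule sum_diff) (auto simp: B_def)
    ultimately show ?thesis
      by (simp add: B_def)
  qed
  with m that show ?thesis
    by (auto simp: M_def)
qed

text \<open>Cutting f at a median gives parts p and q, each supported on at most half the volume.
  Their increments never have the same strict sign, so the two energies add up to at most that of f.
  Shifting by the median can only enlarge the norm because f is orthogonal to constants.\<close>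

lemma cheeger:
  assumes "conductance_ge \<phi>" "\<phi> \<ge> 0" "inn (\<lambda>_. 1) f = 0"
  shows "\<phi>\<^sup>2 * inn f f \<le> energy f"
proof -
  obtain m where m: "2 * vol {x\<in>U. f x > m} \<le> vol U" "2 * vol {x\<in>U. f x < m} \<le> vol U"
    using exists_median .
  define p where "p x = max (f x - m) 0" for x
  define q where "q x = max (m - f x) 0" for x
  have "\<phi>\<^sup>2 * inn p p \<le> energy p"
    using m by (intro cheeger_nonneg assms) (auto simp: p_def less_max_iff_disj)
  moreover have "\<phi>\<^sup>2 * inn q q \<le> energy q"
    using m by (intro cheeger_nonneg assms) (auto simp: q_def less_max_iff_disj)
  moreover have "energy p + energy q \<le> energy f"
  proof -
    have "A x y * (p x - p y)\<^sup>2 + A x y * (q x - q y)\<^sup>2 \<le> A x y * (f x - f y)\<^sup>2" for x y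
    proof -
      have f: "f x - f y = (p x - p y) - (q x - q y)"
        by (auto simp: p_def q_def)
      have "(p x - p y) * (q x - q y) \<le> 0"
        by (auto simp: p_def q_def max_def mult_le_0_iff)
      then have "(p x - p y)\<^sup>2 + (q x - q y)\<^sup>2 \<le> (f x - f y)\<^sup>2"
        unfolding f power2_diff[of "p x - p y"] by (simp only: mult.assoc)
      from mult_left_mono[OF this A_nonneg[of x y]] show ?thesis
        by (simp add: algebra_simps)
    qed
    then show ?thesis
      unfolding energy_def by (simp add: sum.distrib[symmetric] sum_mono)
  qed
  ultimately have "\<phi>\<^sup>2 * (inn p p + inn q q) \<le> energy f"
    by (simp add: algebra_simps)
  moreover have "inn f f \<le> inn p p + inn q q"
  proof -
    have "inn p p + inn q q = (\<Sum>x\<in>U. deg x * (f x * f x - 2 * m * f x + m * m))"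
      unfolding inn_def sum.distrib[symmetric]
      by (intro sum.cong refl) (auto simp: p_def q_def max_def algebra_simps)
    also have "\<dots> = inn f f - 2 * m * inn (\<lambda>_. 1) f + m * m * vol U"
      by (simp add: inn_def vol_def algebra_simps sum.distrib sum_subtractf sum_distrib_left)
    finally show ?thesis
      using assms(3) by simp
  qed
  then have "\<phi>\<^sup>2 * inn f f \<le> \<phi>\<^sup>2 * (inn p p + inn q q)"
    by (intro mult_left_mono) auto
  ultimately show ?thesis
    by linarith
qed

section \<open>Contraction in the weighted norm and pointwise mixing\<close>

lemma energy_eq: "energy f = 2 * inn f f - 2 * (\<Sum>x\<in>U. \<Sum>y\<in>U. A x y * f x * f y)"
proof -
  have "energy f = (\<Sum>x\<in>U. \<Sum>y\<in>U. A x y * (f x)\<^sup>2 + A x y * (f y)\<^sup>2 - 2 * (A x y * f x * f y))"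
    unfolding energy_def by (intro sum.cong refl) (simp add: power2_diff algebra_simps)
  also have "\<dots> = (\<Sum>x\<in>U. deg x * (f x)\<^sup>2) + (\<Sum>x\<in>U. deg x * (f x)\<^sup>2) - 2 * (\<Sum>x\<in>U. \<Sum>y\<in>U. A x y * f x * f y)"
    by (simp only: sum.distrib sum_subtractf sum_A_left[of "\<lambda>x. (f x)\<^sup>2"] sum_A_right[of "\<lambda>x. (f x)\<^sup>2"] sum_distrib_left)
  finally show ?thesis
    by (simp add: inn_def power2_eq_square mult.assoc)
qed

text \<open>Laziness of the walk is what lets the quadratic form bound the norm of \<open>step f\<close>.\<close>

lemma norm_step: "inn (step f) (step f) \<le> inn f f - energy f / 4"
proof -
  \<comment> \<open>The non-lazy average of f, so that \<open>step f\<close> is the mean of f and Q.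
    It does not increase the norm, and its inner product with f is \<open>inn f f\<close> minus half
    the energy.\<close>
  define Q where "Q x = (\<Sum>y\<in>U. A x y * f y) / deg x" for x
  have stepQ: "step f x = (f x + Q x) / 2" if "x \<in> U" for x
    using deg_pos[OF that] by (simp add: step_eq that Q_def field_simps)
  have QQ: "inn Q Q \<le> inn f f"
  proof -
    have "deg x * Q x * Q x \<le> (\<Sum>y\<in>U. A x y * (f y)\<^sup>2)" if "x \<in> U" for x
    proof -
      have "(\<Sum>y\<in>U. A x y * 1 * f y)\<^sup>2 \<le> (\<Sum>y\<in>U. A x y * 1\<^sup>2) * (\<Sum>y\<in>U. A x y * (f y)\<^sup>2)"
        by (rule weighted_Cauchy_Schwarz) (simp add: A_nonneg)
      then have "(\<Sum>y\<in>U. A x y * f y)\<^sup>2 \<le> deg x * (\<Sum>y\<in>U. A x y * (f y)\<^sup>2)"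
        by (simp add: deg_def)
      moreover have "(\<Sum>y\<in>U. A x y * f y) = deg x * Q x"
        using deg_pos[OF that] by (simp add: Q_def)
      ultimately have "deg x * (deg x * Q x * Q x) \<le> deg x * (\<Sum>y\<in>U. A x y * (f y)\<^sup>2)"
        by (simp add: power2_eq_square algebra_simps)
      then show ?thesis
        using deg_pos[OF that] by simp
    qed
    then have "inn Q Q \<le> (\<Sum>x\<in>U. \<Sum>y\<in>U. A x y * (f y)\<^sup>2)"
      unfolding inn_def by (intro sum_mono)
    also have "\<dots> = inn f f"
      unfolding sum_A_right[of "\<lambda>x. (f x)\<^sup>2"] by (simp add: inn_def power2_eq_square mult.assoc)
    finally show ?thesis .
  qed
  have fQ: "inn f Q = (\<Sum>x\<in>U. \<Sum>y\<in>U. A x y * f x * f y)"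
    unfolding inn_def
  proof (intro sum.cong refl)
    fix x assume "x \<in> U"
    then show "deg x * f x * Q x = (\<Sum>y\<in>U. A x y * f x * f y)"
      using deg_pos[of x] by (simp add: Q_def sum_distrib_left field_simps)
  qed
  have "inn (step f) (step f) = (\<Sum>x\<in>U. (deg x * f x * f x + 2 * (deg x * f x * Q x) + deg x * Q x * Q x) / 4)"
    unfolding inn_def by (intro sum.cong refl) (simp add: stepQ field_simps)
  also have "\<dots> = (inn f f + 2 * inn f Q + inn Q Q) / 4"
    by (simp add: inn_def sum.distrib sum_divide_distrib sum_distrib_left add_divide_distrib)
  finally show ?thesis
    using QQ by (simp add: energy_eq fQ field_simps)
qed

lemma norm_steps:
  assumes "conductance_ge \<phi>" "0 \<le> \<phi>" "\<phi> \<le> 1" "inn (\<lambda>_. 1) f = 0"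
  shows "inn ((step ^^ n) f) ((step ^^ n) f) \<le> (1 - \<phi>\<^sup>2 / 4) ^ n * inn f f"
proof (induction n)
  case (Suc n)
  define g where "g = (step ^^ n) f"
  have "inn (\<lambda>_. 1) g = 0"
    using assms by (simp add: g_def inn_one_steps)
  then have "\<phi>\<^sup>2 * inn g g \<le> energy g"
    using assms by (intro cheeger)
  then have "inn (step g) (step g) \<le> (1 - \<phi>\<^sup>2 / 4) * inn g g"
    using norm_step[of g] by (simp add: algebra_simps)
  also have "\<dots> \<le> (1 - \<phi>\<^sup>2 / 4) * ((1 - \<phi>\<^sup>2 / 4) ^ n * inn f f)"
    using Suc power_le_one[of \<phi> 2] assms by (intro mult_left_mono) (auto simp: g_def)
  finally show ?case
    by (simp add: g_def)
qed simp

text \<open>A relative error of 1/2 yields lower as well as upper bounds on transition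
  probabilities. All times from k on are included because the stretches between marked steps have
  varying lengths.\<close>

definition mixing :: "nat \<Rightarrow> bool" where
  "mixing k \<longleftrightarrow> (\<forall>n\<ge>k. \<forall>x\<in>U. \<forall>y\<in>U.
     \<bar>(step ^^ n) (\<lambda>z. of_bool (z = y)) x - deg y / vol U\<bar> \<le> deg y / (2 * vol U))"

text \<open>Norm decay applied to the centred indicator of y, whose squared norm is at most
  \<open>deg y\<close>. As degrees are at least 1, the weighted norm dominates each single value,
  and \<open>deg y\<close> may be replaced by its square, which turns the error into one relative to
  the stationary weight.\<close>

lemma mixingI:
  assumes "conductance_ge \<phi>" "0 \<le> \<phi>" "\<phi> \<le> 1" "(1 - \<phi>\<^sup>2 / 4) ^ k \<le> 1 / (4 * (vol U)\<^sup>2)"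
    and "\<And>x. x \<in> U \<Longrightarrow> deg x \<ge> 1"
  shows "mixing k"
  unfolding mixing_def
proof (intro allI impI ballI)
  fix n x y assume n: "n \<ge> k" and x: "x \<in> U" and y: "y \<in> U"
  define c where "c = deg y / vol U"
  define f where "f z = of_bool (z = y) - c" for z
  have vol: "vol U > 0" "deg y > 0"
    using vol_pos[OF x] deg_pos[OF y] by auto
  have "inn (\<lambda>_. 1) f = (\<Sum>z\<in>U. deg z * of_bool (z = y)) - vol U * c"
    unfolding inn_def vol_def sum_distrib_right sum_subtractf[symmetric]
    by (intro sum.cong) (auto simp: f_def algebra_simps)
  also have "(\<Sum>z\<in>U. deg z * of_bool (z = y)) = deg y"
    by (rule sum_point[OF y])
  finally have f1: "inn (\<lambda>_. 1) f = 0"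
    using vol by (simp add: c_def)
  have "inn f f = inn (\<lambda>z. of_bool (z = y)) f - c * inn (\<lambda>_. 1) f"
    unfolding inn_def sum_distrib_left sum_subtractf[symmetric]
    by (intro sum.cong) (auto simp: f_def algebra_simps)
  also have "\<dots> = (\<Sum>z\<in>U. deg z * f z * of_bool (z = y))"
    using f1 by (simp add: inn_def mult.commute mult.left_commute)
  also have "\<dots> = deg y * (1 - c)"
    by (subst sum_point[OF y]) (simp add: f_def)
  also have "\<dots> \<le> deg y * 1"
    using vol by (intro mult_left_mono) (auto simp: c_def)
  finally have ff: "inn f f \<le> deg y" by simp
  define g where "g = (step ^^ n) f"
  have phi: "0 \<le> 1 - \<phi>\<^sup>2 / 4" "1 - \<phi>\<^sup>2 / 4 \<le> 1"
    using power_le_one[of \<phi> 2] assms by auto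
  have s1: "(g x)\<^sup>2 \<le> deg x * g x * g x"
    using assms(5)[OF x] mult_right_mono[of 1 "deg x" "(g x)\<^sup>2"] by (simp add: power2_eq_square mult.assoc)
  have s2: "deg x * g x * g x \<le> inn g g"
    unfolding inn_def using x by (intro member_le_sum) (auto simp: mult.assoc)
  have s3: "inn g g \<le> (1 - \<phi>\<^sup>2 / 4) ^ n * inn f f"
    unfolding g_def by (intro norm_steps assms f1)
  have s4: "(1 - \<phi>\<^sup>2 / 4) ^ n * inn f f \<le> (1 - \<phi>\<^sup>2 / 4) ^ k * deg y"
    using phi n ff by (intro mult_mono power_decreasing) (auto simp: inn_def sum_nonneg mult.assoc)
  have s5: "(1 - \<phi>\<^sup>2 / 4) ^ k * deg y \<le> 1 / (4 * (vol U)\<^sup>2) * deg y"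
    using vol by (intro mult_right_mono assms) auto
  have s6: "1 / (4 * (vol U)\<^sup>2) * deg y \<le> 1 / (4 * (vol U)\<^sup>2) * (deg y)\<^sup>2"
    using assms(5)[OF y] by (intro mult_left_mono) (auto simp: power2_eq_square)
  have s7: "1 / (4 * (vol U)\<^sup>2) * (deg y)\<^sup>2 = (deg y / (2 * vol U))\<^sup>2"
    by (simp add: power_divide power_mult_distrib)
  have "(g x)\<^sup>2 \<le> (deg y / (2 * vol U))\<^sup>2"
    using s1 s2 s3 s4 s5 s6 s7 by linarith
  then have "\<bar>g x\<bar> \<le> deg y / (2 * vol U)"
    by (rule power2_le_imp_le[of "\<bar>g x\<bar>", simplified power2_abs]) (use vol in auto)
  moreover have "g x = (step ^^ n) (\<lambda>z. of_bool (z = y)) x - deg y / vol U"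
    unfolding g_def f_def c_def by (simp add: steps_diff steps_const x)
  ultimately show "\<bar>(step ^^ n) (\<lambda>z. of_bool (z = y)) x - deg y / vol U\<bar> \<le> deg y / (2 * vol U)"
    by simp
qed

section \<open>Expectations over walks and the Markov property\<close>

text \<open>\<open>walk_sum n g x\<close> is the expectation of \<open>g\<close> over the lazy walk with \<open>n\<close> steps from \<open>x\<close>,
  listed with its \<open>n + 1\<close> vertices.\<close>

primrec walk_sum :: "nat \<Rightarrow> ('a list \<Rightarrow> real) \<Rightarrow> 'a \<Rightarrow> real" where
  "walk_sum 0 g x = g [x]"
| "walk_sum (Suc n) g x = (\<Sum>z\<in>U. ker x z * walk_sum n (\<lambda>w. g (x # w)) z)"

text \<open>Positive kernel values include standing still, so consecutive vertices may
  coincide.\<close>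

definition is_walk :: "nat \<Rightarrow> 'a \<Rightarrow> 'a list \<Rightarrow> bool" where
  "is_walk n x w \<longleftrightarrow> length w = Suc n \<and> hd w = x \<and> set w \<subseteq> U \<and> (\<forall>i<n. ker (w ! i) (w ! Suc i) > 0)"

text \<open>The walk operator killed unless the move lies in R. Applied to the constant 1 it gives
  the probability that the next move lies in R.\<close>

definition rstep :: "('a \<Rightarrow> 'a \<Rightarrow> bool) \<Rightarrow> ('a \<Rightarrow> real) \<Rightarrow> 'a \<Rightarrow> real" where
  "rstep R f x = (\<Sum>z\<in>U. ker x z * of_bool (R x z) * f z)"

lemma walk_sum_cong:
  "x \<in> U \<Longrightarrow> (\<And>w. length w = Suc n \<Longrightarrow> hd w = x \<Longrightarrow> g w = g' w) \<Longrightarrow> walk_sum n g x = walk_sum n g' x"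
proof (induction n arbitrary: g g' x)
  case (Suc n)
  have "walk_sum n (\<lambda>w. g (x # w)) z = walk_sum n (\<lambda>w. g' (x # w)) z" if "z \<in> U" for z
    using that by (rule Suc.IH) (simp add: Suc.prems(2))
  then show ?case
    by simp
qed simp

lemma walk_sum_diff: "walk_sum n (\<lambda>w. g w - g' w) x = walk_sum n g x - walk_sum n g' x"
  by (induction n arbitrary: g g' x) (auto simp: right_diff_distrib sum_subtractf)

lemma walk_sum_cmult: "walk_sum n (\<lambda>w. a * g w) x = a * walk_sum n g x"
  by (induction n arbitrary: g x) (auto simp: sum_distrib_left mult.left_commute)

lemma walk_sum_sum: "walk_sum n (\<lambda>w. \<Sum>i\<in>I. g i w) x = (\<Sum>i\<in>I. walk_sum n (g i) x)"
proof (induction n arbitrary: g x)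
  case (Suc n)
  then show ?case
    by (simp add: sum_distrib_left) (rule sum.swap)
qed simp

text \<open>First-moment method: a positive expectation forces a positive value on some walk of
  positive probability.\<close>

lemma walk_sum_posE:
  assumes "walk_sum n g x > 0" "x \<in> U"
  shows "\<exists>w. is_walk n x w \<and> g w > 0"
  using assms
proof (induction n arbitrary: g x)
  case 0
  then show ?case
    by (intro exI[of _ "[x]"]) (auto simp: is_walk_def)
next
  case (Suc n)
  obtain z where z: "z \<in> U" "ker x z * walk_sum n (\<lambda>w. g (x # w)) z > 0"
    using Suc.prems(1) sum_nonpos[of U "\<lambda>z. ker x z * walk_sum n (\<lambda>w. g (x # w)) z"]
    by (force simp: not_less)
  then have pos: "ker x z > 0" "walk_sum n (\<lambda>w. g (x # w)) z > 0"
    using ker_nonneg[of x z] by (auto simp: zero_less_mult_iff)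
  then obtain w where w: "is_walk n z w" "g (x # w) > 0"
    using Suc.IH z by blast
  have "is_walk (Suc n) x (x # w)"
    using w(1) pos(1) Suc.prems(2) unfolding is_walk_def
    by (cases w) (auto simp: nth_Cons split: nat.splits)
  with w show ?case
    by blast
qed

text \<open>The Markov property at time i, for functions that see only the walk from that time
  on.\<close>

lemma walk_sum_drop:
  "x \<in> U \<Longrightarrow> walk_sum (i + n) (\<lambda>w. g (drop i w)) x = (step ^^ i) (walk_sum n g) x"
proof (induction i arbitrary: x)
  case (Suc i)
  then show ?case
    by (simp add: step_def)
qed simp

lemma walk_sum_last:
  assumes "x \<in> U"
  shows "walk_sum n (\<lambda>w. f (last w)) x = (step ^^ n) f x"
proof -
  have "walk_sum n (\<lambda>w. f (last w)) x = walk_sum (n + 0) (\<lambda>w. f (hd (drop n w))) x"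
    unfolding add_0_right
  proof (rule walk_sum_cong[OF assms])
    fix w :: "'a list"
    assume "length w = Suc n"
    then show "f (last w) = f (hd (drop n w))"
      by (subst last_conv_nth) (auto simp: hd_drop_conv_nth)
  qed
  also have "\<dots> = (step ^^ n) (walk_sum 0 (\<lambda>w. f (hd w))) x"
    using assms by (rule walk_sum_drop)
  also have "walk_sum 0 (\<lambda>w. f (hd w)) = f"
    by (simp add: fun_eq_iff)
  finally show ?thesis .
qed

lemma walk_sum_at:
  assumes "x \<in> U"
  shows "walk_sum (i + Suc n) (\<lambda>w. of_bool (R (w ! i) (w ! Suc i)) * g (drop (Suc i) w)) x =
     (step ^^ i) (rstep R (walk_sum n g)) x"
proof -
  define h where "h w = of_bool (R (w ! 0) (w ! Suc 0)) * g (tl w)" for w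
  have "walk_sum (i + Suc n) (\<lambda>w. of_bool (R (w ! i) (w ! Suc i)) * g (drop (Suc i) w)) x =
      walk_sum (i + Suc n) (\<lambda>w. h (drop i w)) x"
    using assms by (intro walk_sum_cong) (auto simp: h_def drop_Suc tl_drop)
  also have "\<dots> = (step ^^ i) (walk_sum (Suc n) h) x"
    using assms by (rule walk_sum_drop)
  also have "walk_sum (Suc n) h = rstep R (walk_sum n g)"
  proof
    fix u
    have "walk_sum n (\<lambda>w. h (u # w)) z = of_bool (R u z) * walk_sum n g z" if "z \<in> U" for z
    proof -
      have "walk_sum n (\<lambda>w. h (u # w)) z = walk_sum n (\<lambda>w. of_bool (R u z) * g w) z"
      proof (rule walk_sum_cong[OF that])
        fix w :: "'a list"
        assume "length w = Suc n" "hd w = z"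
        then show "h (u # w) = of_bool (R u z) * g w"
          by (cases w) (auto simp: h_def)
      qed
      then show ?thesis
        by (simp only: walk_sum_cmult)
    qed
    then show "walk_sum (Suc n) h u = rstep R (walk_sum n g) u"
      unfolding rstep_def walk_sum.simps by (intro sum.cong) auto
  qed
  finally show ?thesis .
qed

lemma walk_sum_single:
  assumes "x \<in> U"
  shows "walk_sum (i + Suc n) (\<lambda>w. of_bool (R (w ! i) (w ! Suc i)) * f (last w)) x =
     (step ^^ i) (rstep R ((step ^^ n) f)) x"
proof -
  have "walk_sum (i + Suc n) (\<lambda>w. of_bool (R (w ! i) (w ! Suc i)) * f (last w)) x =
    walk_sum (i + Suc n) (\<lambda>w. of_bool (R (w ! i) (w ! Suc i)) * f (last (drop (Suc i) w))) x"
    using assms by (intro walk_sum_cong) auto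
  also have "\<dots> = (step ^^ i) (rstep R (walk_sum n (\<lambda>w. f (last w)))) x"
    using assms by (rule walk_sum_at)
  also have "\<dots> = (step ^^ i) (rstep R ((step ^^ n) f)) x"
    using assms by (intro steps_cong) (auto simp: rstep_def walk_sum_last)
  finally show ?thesis .
qed

text \<open>The Markov property at two marked moves, separated into free stretches of i, m and n
  steps. The second marked move starts at time \<open>i + Suc m\<close>, after the first stretch,
  the first marked move and the middle stretch.\<close>

lemma walk_sum_pair:
  assumes "x \<in> U"
  shows "walk_sum (i + Suc (m + Suc n)) (\<lambda>w. of_bool (R (w ! i) (w ! Suc i)) *
        (of_bool (R' (w ! (i + Suc m)) (w ! Suc (i + Suc m))) * f (last w))) x =
     (step ^^ i) (rstep R ((step ^^ m) (rstep R' ((step ^^ n) f)))) x"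
proof -
  define g where "g w = of_bool (R' (w ! m) (w ! Suc m)) * f (last w)" for w
  have "walk_sum (i + Suc (m + Suc n)) (\<lambda>w. of_bool (R (w ! i) (w ! Suc i)) *
        (of_bool (R' (w ! (i + Suc m)) (w ! Suc (i + Suc m))) * f (last w))) x =
    walk_sum (i + Suc (m + Suc n)) (\<lambda>w. of_bool (R (w ! i) (w ! Suc i)) * g (drop (Suc i) w)) x"
    using assms by (intro walk_sum_cong) (auto simp: g_def)
  also have "\<dots> = (step ^^ i) (rstep R (walk_sum (m + Suc n) g)) x"
    using assms by (rule walk_sum_at)
  also have "\<dots> = (step ^^ i) (rstep R ((step ^^ m) (rstep R' ((step ^^ n) f)))) x"
  proof (rule steps_cong[OF _ assms])
    have "walk_sum (m + Suc n) g z = (step ^^ m) (rstep R' ((step ^^ n) f)) z" if "z \<in> U" for z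
      unfolding g_def by (rule walk_sum_single[OF that])
    then show "rstep R (walk_sum (m + Suc n) g) z = rstep R ((step ^^ m) (rstep R' ((step ^^ n) f))) z" for z
      unfolding rstep_def[of R] by (intro sum.cong) auto
  qed
  finally show ?thesis .
qed

section \<open>Decoupling marked steps by mixing and time reversal\<close>

lemma rstep_mono: "(\<And>z. z \<in> U \<Longrightarrow> f z \<le> g z) \<Longrightarrow> rstep R f x \<le> rstep R g x"
  unfolding rstep_def by (intro sum_mono mult_left_mono) auto

lemma rstep_nonneg: "(\<And>z. z \<in> U \<Longrightarrow> f z \<ge> 0) \<Longrightarrow> rstep R f x \<ge> 0"
  unfolding rstep_def by (intro sum_nonneg mult_nonneg_nonneg) auto

lemma steps_nonneg: "(\<And>z. z \<in> U \<Longrightarrow> f z \<ge> 0) \<Longrightarrow> x \<in> U \<Longrightarrow> (step ^^ n) f x \<ge> 0"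
  using steps_mono[of "\<lambda>_. 0" f x n] by (simp add: steps_const)

lemma steps_le: "(\<And>z. z \<in> U \<Longrightarrow> f z \<le> b) \<Longrightarrow> x \<in> U \<Longrightarrow> (step ^^ n) f x \<le> b"
  using steps_mono[of f "\<lambda>_. b" x n] by (simp add: steps_const)

lemma rstep_const: "rstep R (\<lambda>_. b) x = b * rstep R (\<lambda>_. 1) x"
  unfolding rstep_def sum_distrib_left by (intro sum.cong) auto

lemma deg_ker_sym: "x \<in> U \<Longrightarrow> y \<in> U \<Longrightarrow> deg x * ker x y = deg y * ker y x"
  using deg_pos[of x] deg_pos[of y] A_sym[of x y] by (auto simp: ker_def distrib_left)

text \<open>Time reversal: by detailed balance, the adjoint of a restricted step is the step
  restricted to the converse relation.\<close>

lemma inn_rstep_adjoint: "inn f (rstep R g) = inn (rstep (\<lambda>x y. R y x) f) g"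
proof -
  have "inn f (rstep R g) = (\<Sum>x\<in>U. \<Sum>y\<in>U. (deg x * ker x y) * of_bool (R x y) * f x * g y)"
    unfolding inn_def rstep_def by (simp add: sum_distrib_left mult_ac)
  also have "\<dots> = (\<Sum>x\<in>U. \<Sum>y\<in>U. (deg y * ker y x) * of_bool (R x y) * f x * g y)"
    by (intro sum.cong refl) (simp add: deg_ker_sym)
  also have "\<dots> = (\<Sum>y\<in>U. \<Sum>x\<in>U. (deg y * ker y x) * of_bool (R x y) * f x * g y)"
    by (rule sum.swap)
  also have "\<dots> = inn (rstep (\<lambda>x y. R y x) f) g"
    unfolding inn_def rstep_def by (simp add: sum_distrib_left sum_distrib_right mult_ac)
  finally show ?thesis .
qed

lemma inn_mono:
  "(\<And>z. z \<in> U \<Longrightarrow> f z \<le> f' z) \<Longrightarrow> (\<And>z. z \<in> U \<Longrightarrow> g z \<ge> 0) \<Longrightarrow> inn f g \<le> inn f' g"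
  unfolding inn_def by (intro sum_mono mult_right_mono mult_left_mono) auto

lemma inn_sum: "inn f (\<lambda>z. \<Sum>i\<in>I. g i z) = (\<Sum>i\<in>I. inn f (g i))"
  unfolding inn_def sum_distrib_left by (rule sum.swap)

lemma inn_const: "inn (\<lambda>_. b) g = b * inn (\<lambda>_. 1) g"
  by (simp add: inn_def sum_distrib_left mult_ac)

abbreviation point :: "'a \<Rightarrow> 'a \<Rightarrow> real" where
  "point y \<equiv> (\<lambda>z. of_bool (z = y))"

lemma inn_point: "y \<in> U \<Longrightarrow> inn (\<lambda>_. 1) (point y) = deg y"
  by (simp add: inn_def sum_point)

lemma mixing_upper:
  assumes "mixing k" "n \<ge> k" "x \<in> U" "y \<in> U"
  shows "(step ^^ n) (point y) x \<le> 2 * deg y / vol U"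
proof -
  have "\<bar>(step ^^ n) (point y) x - deg y / vol U\<bar> \<le> deg y / (2 * vol U)"
    using assms by (auto simp: mixing_def)
  moreover have "deg y / (2 * vol U) = (deg y / vol U) / 2" "2 * deg y / vol U = 2 * (deg y / vol U)"
    "deg y / vol U \<ge> 0"
    by auto
  ultimately show ?thesis
    by linarith
qed

lemma mixing_lower:
  assumes "mixing k" "n \<ge> k" "x \<in> U" "y \<in> U"
  shows "(step ^^ n) (point y) x \<ge> deg y / (2 * vol U)"
proof -
  have "\<bar>(step ^^ n) (point y) x - deg y / vol U\<bar> \<le> deg y / (2 * vol U)"
    using assms by (auto simp: mixing_def)
  moreover have "deg y / (2 * vol U) = (deg y / vol U) / 2"
    by auto
  ultimately show ?thesis
    by linarith
qed

text \<open>The upper mixing bound averaged over end points with weights h: after k steps the start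
  is forgotten up to a factor 2.\<close>

lemma mixing_upper_inn:
  assumes "mixing k" "n \<ge> k" "x \<in> U" "\<And>z. z \<in> U \<Longrightarrow> h z \<ge> 0"
  shows "(step ^^ n) h x \<le> 2 * inn (\<lambda>_. 1) h / vol U"
proof -
  have "(step ^^ n) h x = (step ^^ n) (\<lambda>z. \<Sum>u\<in>U. h u * point u z) x"
    using assms(3)
  proof (intro steps_cong)
    fix z assume "z \<in> U"
    then show "h z = (\<Sum>u\<in>U. h u * point u z)"
      using sum_point[of z h] by (simp add: eq_commute)
  qed
  also have "\<dots> = (\<Sum>u\<in>U. h u * (step ^^ n) (point u) x)"
    by (simp only: steps_sum steps_cmult)
  also have "\<dots> \<le> (\<Sum>u\<in>U. h u * (2 * deg u / vol U))"
    using assms by (intro sum_mono mult_left_mono mixing_upper)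
  also have "\<dots> = 2 * inn (\<lambda>_. 1) h / vol U"
    by (simp add: inn_def sum_distrib_left sum_divide_distrib mult_ac)
  finally show ?thesis .
qed

text \<open>Enough steps remain after the marked one for the walk to reach y with nearly stationary
  probability from anywhere. The marked step then costs its own probability, whatever happened
  before.\<close>

lemma rstep_early:
  assumes "mixing k" "l \<ge> k" "x \<in> U" "y \<in> U" "\<And>z. z \<in> U \<Longrightarrow> rstep R (\<lambda>_. 1) z \<le> \<epsilon>"
  shows "(step ^^ i) (rstep R ((step ^^ l) (point y))) x \<le> 2 * \<epsilon> * deg y / vol U"
proof (rule steps_le[OF _ assms(3)])
  fix z assume z: "z \<in> U"
  have "rstep R ((step ^^ l) (point y)) z \<le> rstep R (\<lambda>_. 2 * deg y / vol U) z"
    using assms by (intro rstep_mono mixing_upper)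
  also have "\<dots> \<le> 2 * deg y / vol U * \<epsilon>"
    unfolding rstep_const[of _ "2 * deg y / vol U"] using assms(5)[OF z] by (intro mult_left_mono) auto
  finally show "rstep R ((step ^^ l) (point y)) z \<le> 2 * \<epsilon> * deg y / vol U"
    by (simp add: mult_ac)
qed

text \<open>Enough steps precede the marked one to replace the start by the stationary measure. Read
  backwards from y, the marked step belongs to the converse relation, which is why the hypothesis
  bounds that one.\<close>

lemma rstep_late:
  assumes "mixing k" "i \<ge> k" "x \<in> U" "y \<in> U" "\<And>z. z \<in> U \<Longrightarrow> rstep (\<lambda>u v. R v u) (\<lambda>_. 1) z \<le> \<epsilon>"
  shows "(step ^^ i) (rstep R ((step ^^ l) (point y))) x \<le> 2 * \<epsilon> * deg y / vol U"
proof -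
  have nn: "(step ^^ l) (point y) z \<ge> 0" if "z \<in> U" for z
    using that by (intro steps_nonneg) auto
  have "(step ^^ i) (rstep R ((step ^^ l) (point y))) x \<le>
      2 * inn (\<lambda>_. 1) (rstep R ((step ^^ l) (point y))) / vol U"
    using assms nn by (intro mixing_upper_inn rstep_nonneg) auto
  also have "inn (\<lambda>_. 1) (rstep R ((step ^^ l) (point y))) \<le> inn (\<lambda>_. \<epsilon>) ((step ^^ l) (point y))"
    unfolding inn_rstep_adjoint[of _ R] using assms nn by (intro inn_mono) auto
  also have "\<dots> = \<epsilon> * deg y"
    by (simp add: inn_const[of \<epsilon>] inn_one_steps inn_point assms(4))
  finally show ?thesis
    by (simp add: divide_right_mono mult_ac)
qed

section \<open>Repeated colours and the union bound\<close>

context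
  fixes I :: "'c set" and R :: "'c \<Rightarrow> 'a \<Rightarrow> 'a \<Rightarrow> bool" and \<epsilon> :: real
  assumes finite_I: "finite I"
    and R_sym: "R \<alpha> u v = R \<alpha> v u"
    and R_unique: "\<alpha> \<in> I \<Longrightarrow> \<beta> \<in> I \<Longrightarrow> R \<alpha> u v \<Longrightarrow> R \<beta> u v \<Longrightarrow> \<alpha> = \<beta>"
    and R_eps: "\<alpha> \<in> I \<Longrightarrow> z \<in> U \<Longrightarrow> rstep (R \<alpha>) (\<lambda>_. 1) z \<le> \<epsilon>"
    and eps_nonneg: "\<epsilon> \<ge> 0"
begin

lemma inn_rstep_R: "inn f (rstep (R \<alpha>) g) = inn (rstep (R \<alpha>) f) g"
proof -
  have "(\<lambda>u v. R \<alpha> v u) = R \<alpha>"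
    by (intro ext) (rule R_sym)
  then show ?thesis
    by (simp add: inn_rstep_adjoint[of f])
qed

text \<open>Here \<open>R \<alpha>\<close> stands for moves along edges of colour \<alpha>. A move
  has at most one colour, so the restricted steps of all colours together are dominated by one
  unrestricted step; no factor for the number of colours arises.\<close>

lemma sum_rstep_le_step:
  assumes "\<And>z. z \<in> U \<Longrightarrow> f z \<ge> 0"
  shows "(\<Sum>\<alpha>\<in>I. rstep (R \<alpha>) f x) \<le> step f x"
proof -
  have "(\<Sum>\<alpha>\<in>I. rstep (R \<alpha>) f x) = (\<Sum>z\<in>U. ker x z * f z * (\<Sum>\<alpha>\<in>I. of_bool (R \<alpha> x z)))"
    unfolding rstep_def by (subst sum.swap) (simp add: sum_distrib_left mult_ac)
  also have "\<dots> \<le> (\<Sum>z\<in>U. ker x z * f z * 1)"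
  proof (intro sum_mono mult_left_mono)
    fix z assume "z \<in> U"
    have "card {\<alpha>\<in>I. R \<alpha> x z} \<le> Suc 0"
      using R_unique by (subst card_le_Suc0_iff_eq) (auto simp: finite_I)
    then show "(\<Sum>\<alpha>\<in>I. of_bool (R \<alpha> x z)) \<le> (1 :: real)"
      using finite_I by (simp add: of_bool_def sum.If_cases Int_def)
    show "0 \<le> ker x z * f z"
      using assms[OF \<open>z \<in> U\<close>] by simp
  qed
  finally show ?thesis
    by (simp add: step_def)
qed

text \<open>Two steps of the same colour: one of the three stretches of the walk cut out by them
  has length at least \<open>k\<close> and decouples the rest.\<close>

lemma rstep_pair:
  assumes "mixing k" "i \<ge> k \<or> m \<ge> k \<or> l \<ge> k" "x \<in> U" "y \<in> U"
  shows "(\<Sum>\<alpha>\<in>I. (step ^^ i) (rstep (R \<alpha>) ((step ^^ m) (rstep (R \<alpha>) ((step ^^ l) (point y))))) x)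
    \<le> 2 * \<epsilon> * deg y / vol U"
proof -
  define f where "f = (step ^^ l) (point y)"
  define g where "g \<alpha> = rstep (R \<alpha>) f" for \<alpha>
  have f: "f z \<ge> 0" if "z \<in> U" for z
    using that unfolding f_def by (intro steps_nonneg) auto
  then have g: "g \<alpha> z \<ge> 0" for \<alpha> z
    unfolding g_def by (intro rstep_nonneg)
  then have mg: "(step ^^ m) (g \<alpha>) z \<ge> 0" if "z \<in> U" for \<alpha> z
    using that by (intro steps_nonneg)
  have inn_f: "inn (\<lambda>_. 1) f = deg y"
    by (simp add: f_def inn_one_steps inn_point assms)
  have inn_g: "inn (\<lambda>_. 1) (g \<alpha>) \<le> \<epsilon> * deg y" if "\<alpha> \<in> I" for \<alpha>
  proof -
    have "inn (\<lambda>_. 1) (g \<alpha>) \<le> inn (\<lambda>_. \<epsilon>) f"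
      unfolding g_def inn_rstep_R using R_eps[OF that] f by (intro inn_mono)
    then show ?thesis
      by (simp add: inn_const[of \<epsilon>] inn_f)
  qed
  show ?thesis
  proof (cases "i \<ge> k")
    \<comment> \<open>With a long first stretch, the start becomes stationary and the first marked
      step is charged \<epsilon> for each fixed colour. The second is then summed over
      colours.\<close>
    case True
    have "(step ^^ i) (rstep (R \<alpha>) ((step ^^ m) (g \<alpha>))) x \<le> 2 * \<epsilon> * inn (\<lambda>_. 1) (g \<alpha>) / vol U"
      if "\<alpha> \<in> I" for \<alpha>
    proof -
      have "(step ^^ i) (rstep (R \<alpha>) ((step ^^ m) (g \<alpha>))) x \<le>
          2 * inn (\<lambda>_. 1) (rstep (R \<alpha>) ((step ^^ m) (g \<alpha>))) / vol U"
        using assms True mg by (intro mixing_upper_inn rstep_nonneg) auto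
      also have "inn (\<lambda>_. 1) (rstep (R \<alpha>) ((step ^^ m) (g \<alpha>))) \<le> inn (\<lambda>_. \<epsilon>) ((step ^^ m) (g \<alpha>))"
        unfolding inn_rstep_R using R_eps[OF that] mg by (intro inn_mono)
      also have "\<dots> = \<epsilon> * inn (\<lambda>_. 1) (g \<alpha>)"
        by (simp add: inn_const[of \<epsilon>] inn_one_steps)
      finally show ?thesis
        by (simp add: divide_right_mono mult_ac)
    qed
    then have "(\<Sum>\<alpha>\<in>I. (step ^^ i) (rstep (R \<alpha>) ((step ^^ m) (g \<alpha>))) x)
        \<le> (\<Sum>\<alpha>\<in>I. 2 * \<epsilon> * inn (\<lambda>_. 1) (g \<alpha>) / vol U)"
      by (intro sum_mono)
    also have "\<dots> = 2 * \<epsilon> / vol U * inn (\<lambda>_. 1) (\<lambda>z. \<Sum>\<alpha>\<in>I. g \<alpha> z)"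
      by (simp add: inn_sum sum_distrib_left)
    also have "\<dots> \<le> 2 * \<epsilon> / vol U * inn (\<lambda>_. 1) (step f)"
      using eps_nonneg sum_rstep_le_step[OF f]
      unfolding g_def inn_def by (intro mult_left_mono sum_mono) auto
    also have "inn (\<lambda>_. 1) (step f) = deg y"
      using inn_one_steps[of 1 f] by (simp add: inn_f)
    finally show ?thesis
      by (simp add: g_def f_def)
  next
    case False
    \<comment> \<open>Otherwise the second marked step is charged \<epsilon> for each fixed colour,
      uniformly over the vertex where the middle stretch begins, and the first is summed over
      colours.\<close>
    have mg_le: "(step ^^ m) (g \<alpha>) z \<le> 2 * \<epsilon> * deg y / vol U" if "\<alpha> \<in> I" "z \<in> U" for \<alpha> z
    proof (cases "l \<ge> k")
      case True
      then show ?thesis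
        unfolding g_def f_def using assms that R_eps by (intro rstep_early) auto
    next
      case False
      with \<open>\<not> i \<ge> k\<close> have "m \<ge> k"
        using assms(2) by auto
      then have "(step ^^ m) (g \<alpha>) z \<le> 2 * inn (\<lambda>_. 1) (g \<alpha>) / vol U"
        using assms that g by (intro mixing_upper_inn) auto
      also have "\<dots> \<le> 2 * (\<epsilon> * deg y) / vol U"
        using inn_g[OF that(1)] by (intro divide_right_mono) auto
      finally show ?thesis
        by (simp add: mult_ac)
    qed
    have "(\<Sum>\<alpha>\<in>I. (step ^^ i) (rstep (R \<alpha>) ((step ^^ m) (g \<alpha>))) x)
        = (step ^^ i) (\<lambda>z. \<Sum>\<alpha>\<in>I. rstep (R \<alpha>) ((step ^^ m) (g \<alpha>)) z) x"
      by (simp add: steps_sum)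
    also have "\<dots> \<le> 2 * \<epsilon> * deg y / vol U"
    proof (rule steps_le[OF _ assms(3)])
      fix z assume z: "z \<in> U"
      have "(\<Sum>\<alpha>\<in>I. rstep (R \<alpha>) ((step ^^ m) (g \<alpha>)) z)
          \<le> (\<Sum>\<alpha>\<in>I. rstep (R \<alpha>) (\<lambda>_. 2 * \<epsilon> * deg y / vol U) z)"
        using mg_le by (intro sum_mono rstep_mono)
      also have "\<dots> \<le> step (\<lambda>_. 2 * \<epsilon> * deg y / vol U) z"
        using eps_nonneg by (intro sum_rstep_le_step) auto
      also have "\<dots> = 2 * \<epsilon> * deg y / vol U"
        using z by (rule step_const)
      finally show "(\<Sum>\<alpha>\<in>I. rstep (R \<alpha>) ((step ^^ m) (g \<alpha>)) z) \<le> 2 * \<epsilon> * deg y / vol U" .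
    qed
    finally show ?thesis
      by (simp add: g_def f_def)
  qed
qed

text \<open>In units of the stationary weight of y, ending at y has weight at least 1/2, and each
  bad event weighs at most \<open>2 * \<epsilon>\<close>, \<open>2 * \<beta>\<close> or
  \<open>2 * \<tau>\<close>. There are at most \<open>(3 * k)\<^sup>2\<close> pairs of steps,
  \<open>3 * k\<close> single steps for B, and \<open>2 * k\<close> entries plus
  \<open>2 * k\<close> exits for T, whence the coefficients 18, 6 and 8.\<close>

lemma exists_good_walk:
  assumes mix: "mixing k" and x: "x \<in> U" "x \<notin> T" and y: "y \<in> U" "y \<notin> T"
    and B_sym: "\<And>u v. B u v = B v u"
    and B: "\<And>z. z \<in> U \<Longrightarrow> rstep B (\<lambda>_. 1) z \<le> \<beta>"
    and T: "\<And>z. z \<in> U \<Longrightarrow> rstep (\<lambda>u v. u \<notin> T \<and> v \<in> T) (\<lambda>_. 1) z \<le> \<tau>"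
    and small: "18 * (real k)\<^sup>2 * \<epsilon> + 6 * real k * \<beta> + 8 * real k * \<tau> < 1 / 2"
  obtains w where "is_walk (3 * k) x w" "last w = y" "set w \<inter> T = {}"
    "\<And>i. i < 3 * k \<Longrightarrow> \<not> B (w ! i) (w ! Suc i)"
    "\<And>i j \<alpha>. i < j \<Longrightarrow> j < 3 * k \<Longrightarrow> \<alpha> \<in> I \<Longrightarrow> R \<alpha> (w ! i) (w ! Suc i) \<Longrightarrow> \<not> R \<alpha> (w ! j) (w ! Suc j)"
proof -
  define \<pi> where "\<pi> = deg y / vol U"
  have "\<pi> > 0"
    using deg_pos[OF y(1)] vol_pos[OF y(1)] by (simp add: \<pi>_def)
  have sw: "(\<lambda>u v. B v u) = B"
    by (intro ext B_sym)
  define p :: "'a list \<Rightarrow> real" where "p w = point y (last w)" for w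
  define b where "b i w = of_bool (B (w ! i) (w ! Suc i)) * p w" for i w
  \<comment> \<open>Entries into T are counted only while at least k steps remain: treated as late
    events they would reverse to exits, whose probability is not controlled. Exits are counted after
    time k, where reversal makes them entries.\<close>
  define en where "en i w = of_bool (w ! i \<notin> T \<and> w ! Suc i \<in> T) * p w" for i w
  define lv where "lv i w = of_bool (w ! Suc i \<notin> T \<and> w ! i \<in> T) * p w" for i w
  define rp where "rp i j w = (\<Sum>\<alpha>\<in>I. of_bool (R \<alpha> (w ! i) (w ! Suc i)) *
      (of_bool (R \<alpha> (w ! j) (w ! Suc j)) * p w))" for i j w
  have single: "walk_sum (3 * k) (\<lambda>w. of_bool (Q (w ! i) (w ! Suc i)) * p w) x \<le> 2 * \<delta> * \<pi>"
    if "i < 3 * k" and early: "i < 2 * k \<Longrightarrow> \<forall>z\<in>U. rstep Q (\<lambda>_. 1) z \<le> \<delta>"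
      and late: "i \<ge> 2 * k \<Longrightarrow> \<forall>z\<in>U. rstep (\<lambda>u v. Q v u) (\<lambda>_. 1) z \<le> \<delta>" for i Q \<delta>
  proof -
    from \<open>i < 3 * k\<close> obtain n where n: "3 * k = i + Suc n"
      by (metis less_iff_Suc_add add_Suc_right)
    have "(step ^^ i) (rstep Q ((step ^^ n) (point y))) x \<le> 2 * \<delta> * deg y / vol U"
    proof (cases "i < 2 * k")
      case True
      with n early show ?thesis
        by (intro rstep_early[where k = k] mix x y) auto
    next
      case False
      with n late show ?thesis
        by (intro rstep_late[where k = k] mix x y) auto
    qed
    then show ?thesis
      unfolding n p_def using walk_sum_single[OF x(1), of i n Q "point y"] by (simp add: \<pi>_def)
  qed
  have single': "walk_sum (3 * k) (\<lambda>w. of_bool (Q (w ! i) (w ! Suc i)) * p w) x \<le> 2 * \<delta> * \<pi>"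
    if "k \<le> i" "i < 3 * k" "\<forall>z\<in>U. rstep (\<lambda>u v. Q v u) (\<lambda>_. 1) z \<le> \<delta>" for i Q \<delta>
  proof -
    from \<open>i < 3 * k\<close> obtain n where n: "3 * k = i + Suc n"
      by (metis less_iff_Suc_add add_Suc_right)
    have "(step ^^ i) (rstep Q ((step ^^ n) (point y))) x \<le> 2 * \<delta> * deg y / vol U"
      using that by (intro rstep_late[where k = k] mix x y) auto
    then show ?thesis
      unfolding n p_def using walk_sum_single[OF x(1), of i n Q "point y"] by (simp add: \<pi>_def)
  qed
  have wb: "walk_sum (3 * k) (b i) x \<le> 2 * \<beta> * \<pi>" if "i < 3 * k" for i
    unfolding b_def using that B by (intro single) (auto simp: sw)
  have wen: "walk_sum (3 * k) (en i) x \<le> 2 * \<tau> * \<pi>" if "i < 2 * k" for i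
    unfolding en_def using that T by (intro single[of i "\<lambda>u v. u \<notin> T \<and> v \<in> T"]) auto
  have wlv: "walk_sum (3 * k) (lv i) x \<le> 2 * \<tau> * \<pi>" if "k \<le> i" "i < 3 * k" for i
    unfolding lv_def using that T by (intro single'[of i "\<lambda>u v. v \<notin> T \<and> u \<in> T"]) auto
  have wrp: "walk_sum (3 * k) (rp i j) x \<le> 2 * \<epsilon> * \<pi>" if "i < j" "j < 3 * k" for i j
  proof -
    from \<open>i < j\<close> obtain m where m: "j = i + Suc m"
      by (metis less_iff_Suc_add add_Suc_right)
    from \<open>j < 3 * k\<close> obtain n where "3 * k = j + Suc n"
      by (metis less_iff_Suc_add add_Suc_right)
    with m have n: "3 * k = i + Suc (m + Suc n)"
      by simp
    have "walk_sum (3 * k) (rp i j) x =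
        (\<Sum>\<alpha>\<in>I. (step ^^ i) (rstep (R \<alpha>) ((step ^^ m) (rstep (R \<alpha>) ((step ^^ n) (point y))))) x)"
      unfolding rp_def walk_sum_sum n m p_def
      by (intro sum.cong refl) (rule walk_sum_pair[OF x(1), of i m n _ _ "point y"])
    also have "\<dots> \<le> 2 * \<epsilon> * deg y / vol U"
    proof (rule rstep_pair[where k = k])
      \<comment> \<open>The three stretches have \<open>3 * k - 2\<close> steps in total, while
        three stretches shorter than k have at most \<open>3 * k - 3\<close>.\<close>
      show "i \<ge> k \<or> m \<ge> k \<or> n \<ge> k"
        using n by linarith
    qed (fact finite_I R_sym R_unique R_eps eps_nonneg mix x y)+
    finally show ?thesis
      by (simp add: \<pi>_def)
  qed
  \<comment> \<open>The indicator of ending at y minus the number of bad events among the walks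
    ending there. Where it is positive, the indicator is 1 and every count is 0.\<close>
  define g where "g w = p w - (\<Sum>i<3 * k. b i w) - (\<Sum>i<2 * k. en i w) - (\<Sum>i\<in>{k..<3 * k}. lv i w)
      - (\<Sum>i<3 * k. \<Sum>j\<in>{i<..<3 * k}. rp i j w)" for w
  have "walk_sum (3 * k) p x \<ge> \<pi> / 2"
    unfolding p_def walk_sum_last[OF x(1), of _ "point y"] 
    using mixing_lower[OF mix _ x(1) y(1), of "3 * k"] by (simp add: \<pi>_def)
  moreover have "(\<Sum>i<3 * k. walk_sum (3 * k) (b i) x) \<le> 3 * real k * (2 * \<beta> * \<pi>)"
    using sum_bounded_above[of "{..<3 * k}" "\<lambda>i. walk_sum (3 * k) (b i) x" "2 * \<beta> * \<pi>"] wb by simp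
  moreover have "(\<Sum>i<2 * k. walk_sum (3 * k) (en i) x) \<le> 2 * real k * (2 * \<tau> * \<pi>)"
    using sum_bounded_above[of "{..<2 * k}" "\<lambda>i. walk_sum (3 * k) (en i) x" "2 * \<tau> * \<pi>"] wen by simp
  moreover have "(\<Sum>i\<in>{k..<3 * k}. walk_sum (3 * k) (lv i) x) \<le> 2 * real k * (2 * \<tau> * \<pi>)"
    using sum_bounded_above[of "{k..<3 * k}" "\<lambda>i. walk_sum (3 * k) (lv i) x" "2 * \<tau> * \<pi>"] wlv by simp
  moreover have "(\<Sum>i<3 * k. \<Sum>j\<in>{i<..<3 * k}. walk_sum (3 * k) (rp i j) x)
      \<le> 3 * real k * (3 * real k * (2 * \<epsilon> * \<pi>))"
  proof -
    have nn: "2 * \<epsilon> * \<pi> \<ge> 0"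
      using eps_nonneg \<open>\<pi> > 0\<close> by simp
    have "(\<Sum>j\<in>{i<..<3 * k}. walk_sum (3 * k) (rp i j) x) \<le> 3 * real k * (2 * \<epsilon> * \<pi>)" for i
    proof -
      have "(\<Sum>j\<in>{i<..<3 * k}. walk_sum (3 * k) (rp i j) x) \<le> real (card {i<..<3 * k}) * (2 * \<epsilon> * \<pi>)"
        using wrp by (intro sum_bounded_above) auto
      also have "\<dots> \<le> 3 * real k * (2 * \<epsilon> * \<pi>)"
        using nn by (intro mult_right_mono) auto
      finally show ?thesis .
    qed
    then show ?thesis
      using sum_bounded_above[of "{..<3 * k}" "\<lambda>i. (\<Sum>j\<in>{i<..<3 * k}. walk_sum (3 * k) (rp i j) x)"
          "3 * real k * (2 * \<epsilon> * \<pi>)"] by simp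
  qed
  moreover have "walk_sum (3 * k) g x = walk_sum (3 * k) p x - (\<Sum>i<3 * k. walk_sum (3 * k) (b i) x)
      - (\<Sum>i<2 * k. walk_sum (3 * k) (en i) x) - (\<Sum>i\<in>{k..<3 * k}. walk_sum (3 * k) (lv i) x)
      - (\<Sum>i<3 * k. \<Sum>j\<in>{i<..<3 * k}. walk_sum (3 * k) (rp i j) x)"
    unfolding g_def by (simp only: walk_sum_diff walk_sum_sum)
  ultimately have "walk_sum (3 * k) g x \<ge> \<pi> / 2 - 3 * real k * (2 * \<beta> * \<pi>) - 2 * real k * (2 * \<tau> * \<pi>)
      - 2 * real k * (2 * \<tau> * \<pi>) - 3 * real k * (3 * real k * (2 * \<epsilon> * \<pi>))"
    by linarith
  moreover have "\<pi> / 2 - 3 * real k * (2 * \<beta> * \<pi>) - 2 * real k * (2 * \<tau> * \<pi>)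
      - 2 * real k * (2 * \<tau> * \<pi>) - 3 * real k * (3 * real k * (2 * \<epsilon> * \<pi>)) =
      \<pi> * (1 / 2 - (18 * (real k)\<^sup>2 * \<epsilon> + 6 * real k * \<beta> + 8 * real k * \<tau>))"
    by (simp add: algebra_simps power2_eq_square)
  moreover have "\<pi> * (1 / 2 - (18 * (real k)\<^sup>2 * \<epsilon> + 6 * real k * \<beta> + 8 * real k * \<tau>)) > 0"
    using small \<open>\<pi> > 0\<close> by (intro mult_pos_pos) auto
  ultimately have "walk_sum (3 * k) g x > 0"
    by linarith
  then obtain w where w: "is_walk (3 * k) x w" "g w > 0"
    using walk_sum_posE x(1) by blast
  have len: "length w = Suc (3 * k)" and w0: "w ! 0 = x"
    using w(1) by (cases w; auto simp: is_walk_def)+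
  have nn: "b i w \<ge> 0" "en i w \<ge> 0" "lv i w \<ge> 0" "rp i j w \<ge> 0" for i j
    by (auto simp: b_def en_def lv_def rp_def p_def intro!: sum_nonneg)
  have nns: "(\<Sum>i<3 * k. b i w) \<ge> 0" "(\<Sum>i<2 * k. en i w) \<ge> 0" "(\<Sum>i\<in>{k..<3 * k}. lv i w) \<ge> 0"
    "(\<Sum>i<3 * k. \<Sum>j\<in>{i<..<3 * k}. rp i j w) \<ge> 0"
    using nn by (auto intro!: sum_nonneg)
  have last: "last w = y"
  proof (rule ccontr)
    assume "last w \<noteq> y"
    then have "p w = 0"
      by (simp add: p_def)
    with w(2) nns show False
      by (simp add: g_def)
  qed
  then have p1: "p w = 1"
    by (simp add: p_def)
  have wl: "w ! (3 * k) = y"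
    using last len by (metis diff_Suc_1 last_conv_nth length_0_conv nat.distinct(1))
  have not_b: "\<not> B (w ! i) (w ! Suc i)" if "i < 3 * k" for i
  proof
    assume "B (w ! i) (w ! Suc i)"
    then have "1 \<le> b i w"
      by (simp add: b_def p1)
    also have "\<dots> \<le> (\<Sum>i<3 * k. b i w)"
      using that nn by (intro member_le_sum) auto
    finally show False
      using w(2) nns p1 by (simp add: g_def)
  qed
  have not_en: "\<not> (w ! i \<notin> T \<and> w ! Suc i \<in> T)" if "i < 2 * k" for i
  proof
    assume "w ! i \<notin> T \<and> w ! Suc i \<in> T"
    then have "1 \<le> en i w"
      by (simp add: en_def p1)
    also have "\<dots> \<le> (\<Sum>i<2 * k. en i w)"
      using that nn by (intro member_le_sum) auto
    finally show False
      using w(2) nns p1 by (simp add: g_def)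
  qed
  have not_lv: "\<not> (w ! i \<in> T \<and> w ! Suc i \<notin> T)" if "k \<le> i" "i < 3 * k" for i
  proof
    assume "w ! i \<in> T \<and> w ! Suc i \<notin> T"
    then have "1 \<le> lv i w"
      by (simp add: lv_def p1)
    also have "\<dots> \<le> (\<Sum>i\<in>{k..<3 * k}. lv i w)"
      using that nn by (intro member_le_sum) auto
    finally show False
      using w(2) nns p1 by (simp add: g_def)
  qed
  have not_rp: "\<not> R \<alpha> (w ! j) (w ! Suc j)"
    if "i < j" "j < 3 * k" "\<alpha> \<in> I" "R \<alpha> (w ! i) (w ! Suc i)" for i j \<alpha>
  proof
    assume "R \<alpha> (w ! j) (w ! Suc j)"
    then have "1 \<le> of_bool (R \<alpha> (w ! i) (w ! Suc i)) * (of_bool (R \<alpha> (w ! j) (w ! Suc j)) * p w)"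
      using that by (simp add: p1)
    also have "\<dots> \<le> rp i j w"
      unfolding rp_def using that finite_I by (intro member_le_sum) (auto simp: p1)
    also have "\<dots> \<le> (\<Sum>j\<in>{i<..<3 * k}. rp i j w)"
      using that nn by (intro member_le_sum) auto
    also have "\<dots> \<le> (\<Sum>i<3 * k. \<Sum>j\<in>{i<..<3 * k}. rp i j w)"
      using that nn by (intro member_le_sum[of i "{..<3 * k}" "\<lambda>i. \<Sum>j\<in>{i<..<3 * k}. rp i j w"])
        (auto intro!: sum_nonneg)
    finally show False
      using w(2) nns p1 by (simp add: g_def)
  qed
  \<comment> \<open>A visit to T by time \<open>2 * k\<close> is preceded by an entry, as x lies
    outside T; a later visit is followed by an exit, as y does. Both fall within the counted
    ranges.\<close>
  have "set w \<inter> T = {}"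
  proof (rule ccontr)
    assume "set w \<inter> T \<noteq> {}"
    then obtain t where t: "t \<le> 3 * k" "w ! t \<in> T"
      using len by (auto simp: in_set_conv_nth less_Suc_eq_le)
    show False
    proof (cases "t \<le> 2 * k")
      case True
      obtain i where "0 \<le> i" "i < t" "w ! i \<notin> T" "\<not> w ! Suc i \<notin> T"
        using exists_switch[of "\<lambda>i. w ! i \<notin> T" 0 t] t x(2) w0 by auto
      with not_en[of i] True show False
        by auto
    next
      case False
      obtain i where "t \<le> i" "i < 3 * k" "w ! i \<in> T" "w ! Suc i \<notin> T"
        using exists_switch[of "\<lambda>i. w ! i \<in> T" t "3 * k"] t y(2) wl by auto
      with not_lv[of i] False show False
        by auto
    qed
  qed
  then show ?thesis
    using that w(1) last not_b not_rp by blast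
qed

end

end

subsection \<open>Rainbow paths in well-mixing graphs\<close>

lemma path_edges_single [simp]: "path_edges [a] = {}"
  by (simp add: path_edges_def)

lemma path_edges_Cons [simp]: "path_edges (a # b # p) = insert {a, b} (path_edges (b # p))"
proof -
  have "path_edges (a # b # p) = (\<lambda>i. {(a # b # p) ! i, (a # b # p) ! Suc i}) ` {..<Suc (length p)}"
    by (auto simp: path_edges_def)
  also have "{..<Suc (length p)} = insert 0 (Suc ` {..<length p})"
    by (rule lessThan_Suc_eq_insert_0)
  also have "(\<lambda>i. {(a # b # p) ! i, (a # b # p) ! Suc i}) ` \<dots> =
      insert {a, b} ((\<lambda>i. {(b # p) ! i, (b # p) ! Suc i}) ` {..<length p})"
    by (simp add: image_image)
  also have "(\<lambda>i. {(b # p) ! i, (b # p) ! Suc i}) ` {..<length p} = path_edges (b # p)"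
    by (auto simp: path_edges_def)
  finally show ?thesis .
qed

lemma path_edges_suffix: "path_edges (a # q) \<subseteq> path_edges (p @ a # q)"
proof (induction p)
  case (Cons b p)
  then show ?case
    by (cases p) auto
qed simp

lemma finite_path_edges [simp]: "finite (path_edges p)"
proof (induction p)
  case Nil
  then show ?case
    by (simp add: path_edges_def)
next
  case (Cons a p)
  then show ?case
    by (cases p) auto
qed

lemma card_path_edges_le: "card (path_edges p) \<le> length p"
proof (induction p)
  case Nil
  then show ?case
    by (simp add: path_edges_def)
next
  case (Cons a p)
  then show ?case
    by (cases p) (auto intro: le_trans[OF card_insert_le_m1])
qed

lemma path_edges_subset: "e \<in> path_edges p \<Longrightarrow> e \<subseteq> set p"
  by (auto simp: path_edges_def)

lemma card_path_edge: "is_path p \<Longrightarrow> e \<in> path_edges p \<Longrightarrow> card e = 2"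
  by (auto simp: path_edges_def is_path_def card_insert_if nth_eq_iff_index_eq)

text \<open>Loop erasure from the back: if the new first vertex already lies on the path, the path
  is cut to start there. Lazy steps of w contribute singletons to \<open>path_edges w\<close>, which
  cannot survive in a path.\<close>

lemma path_of_walk:
  assumes "w \<noteq> []"
  shows "\<exists>p. is_path p \<and> hd p = hd w \<and> last p = last w \<and> set p \<subseteq> set w \<and> path_edges p \<subseteq> path_edges w"
  using assms
proof (induction w rule: list_nonempty_induct)
  case (single a)
  then show ?case
    by (intro exI[of _ "[a]"]) (auto simp: is_path_def)
next
  case (cons a w)
  then obtain p where p: "is_path p" "hd p = hd w" "last p = last w" "set p \<subseteq> set w"
    "path_edges p \<subseteq> path_edges w"
    by blast
  obtain b w' where w: "w = b # w'"
    using cons.hyps by (cases w) auto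
  obtain p' where p': "p = b # p'"
    using p(1,2) w by (cases p) (auto simp: is_path_def)
  show ?case
  proof (cases "a \<in> set p")
    case True
    then obtain us vs where "p = us @ a # vs"
      by (auto simp: in_set_conv_decomp)
    then show ?thesis
      using p w path_edges_suffix[of a vs us]
      by (intro exI[of _ "a # vs"]) (auto simp: is_path_def)
  next
    case False
    then show ?thesis
      using p w p' by (intro exI[of _ "a # p"]) (auto simp: is_path_def)
  qed
qed

abbreviation adj :: "'a set set \<Rightarrow> 'a \<Rightarrow> 'a \<Rightarrow> real" where
  "adj F u v \<equiv> of_bool ({u, v} \<in> F)"

lemma weighted_graph_adj:
  assumes "simple_graph U F" "\<And>x. x \<in> U \<Longrightarrow> (\<Sum>v\<in>U. adj F x v) > 0"
  shows "weighted_graph U (adj F)"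
  by unfold_locales (use assms in \<open>auto simp: simple_graph_def insert_commute\<close>)

text \<open>A move to a given other vertex has probability at most \<open>1 / d\<close>, so a
  colour, the set S and entering T cost \<open>1 / d\<close>, \<open>card S / d\<close> and
  \<open>card T / d\<close>. Edges left after loop erasure are steps of the walk, so distinct ones
  keep distinct colours.\<close>

lemma rainbow_path_avoiding:
  fixes c :: "'a set \<Rightarrow> 'c" and d :: real
  assumes F: "simple_graph U F" and col: "proper_edge_colouring F c"
    and deg: "\<And>x. x \<in> U \<Longrightarrow> d \<le> (\<Sum>v\<in>U. adj F x v)" and d: "d > 0"
    and mix: "weighted_graph.mixing U (adj F) k"
    and x: "x \<in> U" "x \<notin> T" and y: "y \<in> U" "y \<notin> T" and fin: "finite S" "finite T"
    and small: "18 * (real k)\<^sup>2 + 6 * real k * real (card S) + 8 * real k * real (card T) < d / 2"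
  shows "\<exists>p. is_path p \<and> hd p = x \<and> last p = y \<and> set p \<subseteq> U - T \<and> path_edges p \<subseteq> F \<and>
    inj_on c (path_edges p) \<and> c ` path_edges p \<inter> S = {} \<and> length p \<le> 3 * k + 1"
proof -
  interpret weighted_graph U "adj F"
  proof (rule weighted_graph_adj[OF F])
    fix x assume "x \<in> U"
    then show "(\<Sum>v\<in>U. adj F x v) > 0"
      using deg[of x] d by linarith
  qed
  have loop: "{u, v} \<in> F \<Longrightarrow> u \<noteq> v" for u v
    using F by (auto simp: simple_graph_def)
  have finF: "finite F"
    using F by (intro finite_subset[of F "Pow U"]) (auto simp: simple_graph_def)
  have ker_le: "ker z v \<le> 1 / d" if "z \<in> U" "z \<noteq> v" for z v
  proof -
    have "ker z v \<le> 1 / (2 * deg z)"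
      using that by (simp add: ker_def)
    also have "\<dots> \<le> 1 / d"
      using deg[OF that(1)] d by (intro divide_left_mono) (auto simp: deg_def)
    finally show ?thesis .
  qed
  have rstep_le: "rstep Q (\<lambda>_. 1) z \<le> real N / d"
    if "z \<in> U" "\<And>v. Q z v \<Longrightarrow> z \<noteq> v" "card {v\<in>U. Q z v} \<le> N" for Q z N
  proof -
    have "rstep Q (\<lambda>_. 1) z = (\<Sum>v\<in>{v\<in>U. Q z v}. ker z v)"
      unfolding rstep_def by (intro sum.mono_neutral_cong_right) auto
    also have "\<dots> \<le> real (card {v\<in>U. Q z v}) * (1 / d)"
      using that ker_le by (intro sum_bounded_above) auto
    also have "\<dots> \<le> real N * (1 / d)"
      using that d by (intro mult_right_mono) auto
    finally show ?thesis
      by simp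
  qed
  \<comment> \<open>Properness makes the colour of an edge at z determine its other end.\<close>
  have card_col: "card {v\<in>U. {z, v} \<in> F \<and> c {z, v} \<in> X} \<le> card X" if "finite X" for z X
  proof (rule card_inj_on_le)
    show "inj_on (\<lambda>v. c {z, v}) {v\<in>U. {z, v} \<in> F \<and> c {z, v} \<in> X}"
    proof (rule inj_onI, rule ccontr)
      fix u v assume "u \<in> {v\<in>U. {z, v} \<in> F \<and> c {z, v} \<in> X}" "v \<in> {v\<in>U. {z, v} \<in> F \<and> c {z, v} \<in> X}"
        "c {z, u} = c {z, v}" "u \<noteq> v"
      moreover from this have "{z, u} \<noteq> {z, v}" "{z, u} \<inter> {z, v} \<noteq> {}"
        by (auto simp: doubleton_eq_iff)
      ultimately show False
        using col by (auto simp: proper_edge_colouring_def)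
    qed
  qed (use that in auto)
  define R where "R \<alpha> u v \<longleftrightarrow> {u, v} \<in> F \<and> c {u, v} = \<alpha>" for \<alpha> u v
  define B where "B u v \<longleftrightarrow> {u, v} \<in> F \<and> c {u, v} \<in> S" for u v
  obtain w where w: "is_walk (3 * k) x w" "last w = y" "set w \<inter> T = {}"
    and wB: "\<And>i. i < 3 * k \<Longrightarrow> \<not> B (w ! i) (w ! Suc i)"
    and wR: "\<And>i j \<alpha>. i < j \<Longrightarrow> j < 3 * k \<Longrightarrow> \<alpha> \<in> c ` F \<Longrightarrow> R \<alpha> (w ! i) (w ! Suc i) \<Longrightarrow>
      \<not> R \<alpha> (w ! j) (w ! Suc j)"
  proof (rule exists_good_walk[of "c ` F" R "1 / d" k x T y B "card S / d" "card T / d"])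
    show "finite (c ` F)"
      using finF by simp
    show "R \<alpha> u v = R \<alpha> v u" "B u v = B v u" for \<alpha> u v
      by (simp_all add: R_def B_def insert_commute)
    show "rstep (R \<alpha>) (\<lambda>_. 1) z \<le> 1 / d" if "z \<in> U" for \<alpha> z
      using rstep_le[of z "R \<alpha>" 1] that loop card_col[of "{\<alpha>}" z] by (auto simp: R_def)
    show "rstep B (\<lambda>_. 1) z \<le> card S / d" if "z \<in> U" for z
      using rstep_le[of z B "card S"] that loop card_col[of S z] fin by (auto simp: B_def)
    show "rstep (\<lambda>u v. u \<notin> T \<and> v \<in> T) (\<lambda>_. 1) z \<le> card T / d" if "z \<in> U" for z
    proof (rule rstep_le[OF that])
      show "card {v\<in>U. z \<notin> T \<and> v \<in> T} \<le> card T"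
        using fin by (intro card_mono) auto
    qed auto
    show "18 * (real k)\<^sup>2 * (1 / d) + 6 * real k * (card S / d) + 8 * real k * (card T / d) < 1 / 2"
      using small d by (simp add: field_simps)
  qed (use mix x y d in \<open>auto simp: R_def\<close>)
  have len: "length w = Suc (3 * k)" "hd w = x" "set w \<subseteq> U"
    using w(1) by (auto simp: is_walk_def)
  have step_edge: "{w ! i, w ! Suc i} \<in> F" if "i < 3 * k" "w ! i \<noteq> w ! Suc i" for i
  proof -
    have "ker (w ! i) (w ! Suc i) > 0"
      using w(1) that by (auto simp: is_walk_def)
    then show ?thesis
      using that(2) by (cases "{w ! i, w ! Suc i} \<in> F") (simp_all add: ker_def)
  qed
  obtain p where p: "is_path p" "hd p = hd w" "last p = last w" "set p \<subseteq> set w"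
    "path_edges p \<subseteq> path_edges w"
    using path_of_walk[of w] len by (metis length_0_conv nat.distinct(1))
  have pe: "\<exists>i<3 * k. e = {w ! i, w ! Suc i} \<and> e \<in> F" if "e \<in> path_edges p" for e
  proof -
    have "e \<in> path_edges w"
      using that p(5) by blast
    then obtain i where i: "i < 3 * k" "e = {w ! i, w ! Suc i}"
      using len by (auto simp: path_edges_def)
    \<comment> \<open>An edge of a path has two elements, so it does not come from a lazy
      step.\<close>
    moreover have "w ! i \<noteq> w ! Suc i"
      using card_path_edge[OF p(1) that] i by auto
    ultimately show ?thesis
      using step_edge by blast
  qed
  have "inj_on c (path_edges p)"
  proof (rule inj_onI, rule ccontr)
    fix e f assume ef: "e \<in> path_edges p" "f \<in> path_edges p" "c e = c f" "e \<noteq> f"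
    from pe[OF ef(1)] obtain i where i: "i < 3 * k" "e = {w ! i, w ! Suc i}" "e \<in> F"
      by blast
    from pe[OF ef(2)] obtain j where j: "j < 3 * k" "f = {w ! j, w ! Suc j}" "f \<in> F"
      by blast
    have "i \<noteq> j"
      using i j ef by auto
    moreover have Ri: "R (c e) (w ! i) (w ! Suc i)"
      using i(2,3) by (simp add: R_def)
    moreover have Rj: "R (c e) (w ! j) (w ! Suc j)"
      using j(2,3) ef(3) by (simp add: R_def)
    ultimately show False
      using wR[OF _ j(1) imageI[OF i(3)] Ri] wR[OF _ i(1) imageI[OF i(3)] Rj] by linarith
  qed
  moreover have "c ` path_edges p \<inter> S = {}"
    using pe wB by (fastforce simp: B_def)
  moreover have "length p \<le> 3 * k + 1"
  proof -
    have "length p = card (set p)"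
      using p(1) by (simp add: is_path_def distinct_card)
    also have "\<dots> \<le> card (set w)"
      using p(4) by (intro card_mono) auto
    also have "\<dots> \<le> 3 * k + 1"
      using card_length[of w] len by simp
    finally show ?thesis .
  qed
  moreover have "set p \<subseteq> U - T"
    using p(4) len(3) w(3) by blast
  moreover have "path_edges p \<subseteq> F"
    using pe by blast
  ultimately show ?thesis
    using p(1-3) len(2) w(2) by (intro exI[of _ p]) simp
qed

subsection \<open>Subgraphs of large conductance\<close>

definition edges_in :: "'a set set \<Rightarrow> 'a set \<Rightarrow> 'a set set" where
  "edges_in E U = {e\<in>E. e \<subseteq> U}"

lemma edges_in_mono: "U \<subseteq> U' \<Longrightarrow> edges_in E U \<subseteq> edges_in E U'"
  by (auto simp: edges_in_def)

lemma simple_graph_edges_in: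
  "simple_graph V E \<Longrightarrow> U \<subseteq> V \<Longrightarrow> simple_graph U (edges_in E U)"
  by (auto simp: simple_graph_def edges_in_def intro: finite_subset)

lemma finite_edges: "simple_graph V E \<Longrightarrow> finite E"
  by (intro finite_subset[of E "Pow V"]) (auto simp: simple_graph_def)

lemma handshake:
  assumes "simple_graph V E" "U \<subseteq> V"
  shows "(\<Sum>x\<in>U. \<Sum>y\<in>U. adj E x y) = 2 * real (card (edges_in E U))"
proof -
  have fin: "finite U" "finite (edges_in E U)"
    using simple_graph_edges_in[OF assms] finite_edges[OF simple_graph_edges_in[OF assms]]
    by (auto simp: simple_graph_def)
  have two: "card {q \<in> U \<times> U. {fst q, snd q} = e} = 2" if e: "e \<in> edges_in E U" for e
  proof -
    have "card e = 2" "e \<subseteq> U"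
      using e assms(1) by (auto simp: edges_in_def simple_graph_def)
    then obtain a b where ab: "e = {a, b}" "a \<noteq> b"
      by (meson card_2_iff)
    then have "{q \<in> U \<times> U. {fst q, snd q} = e} = {(a, b), (b, a)}"
      using \<open>e \<subseteq> U\<close> by (auto simp: doubleton_eq_iff)
    with ab show ?thesis
      by simp
  qed
  have "(\<Sum>x\<in>U. \<Sum>y\<in>U. adj E x y) = (\<Sum>q\<in>U \<times> U. of_bool ({fst q, snd q} \<in> E))"
    by (simp add: sum.cartesian_product case_prod_unfold)
  also have "\<dots> = (\<Sum>q\<in>U \<times> U. \<Sum>e\<in>edges_in E U. of_bool ({fst q, snd q} = e))"
    using fin by (intro sum.cong refl) (auto simp: edges_in_def of_bool_def)
  also have "\<dots> = (\<Sum>e\<in>edges_in E U. \<Sum>q\<in>U \<times> U. of_bool ({fst q, snd q} = e))"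
    by (rule sum.swap)
  also have "\<dots> = (\<Sum>e\<in>edges_in E U. 2)"
  proof (intro sum.cong refl)
    fix e assume "e \<in> edges_in E U"
    then show "(\<Sum>q\<in>U \<times> U. of_bool ({fst q, snd q} = e)) = (2 :: real)"
      using two[of e] fin by (simp add: of_bool_def sum.If_cases Int_def)
  qed
  finally show ?thesis
    by simp
qed

lemma edges_in_split:
  assumes "simple_graph V E" "U \<subseteq> V" "S \<subseteq> U"
  shows "real (card (edges_in E U)) = real (card (edges_in E S)) + real (card (edges_in E (U - S)))
      + (\<Sum>x\<in>S. \<Sum>y\<in>U - S. adj E x y)"
proof -
  have fin: "finite U"
    using assms by (auto simp: simple_graph_def intro: finite_subset)
  have split: "(\<Sum>x\<in>U. f x) = (\<Sum>x\<in>S. f x) + (\<Sum>x\<in>U - S. f x)" for f :: "'a \<Rightarrow> real"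
    using sum.subset_diff[OF assms(3) fin, of f] by simp
  have "2 * real (card (edges_in E U)) = (\<Sum>x\<in>U. \<Sum>y\<in>U. adj E x y)"
    using handshake[OF assms(1,2)] by simp
  also have "\<dots> = (\<Sum>x\<in>S. \<Sum>y\<in>S. adj E x y) + (\<Sum>x\<in>S. \<Sum>y\<in>U - S. adj E x y) +
      ((\<Sum>x\<in>U - S. \<Sum>y\<in>S. adj E x y) + (\<Sum>x\<in>U - S. \<Sum>y\<in>U - S. adj E x y))"
    by (simp only: split sum.distrib)
  also have "(\<Sum>x\<in>U - S. \<Sum>y\<in>S. adj E x y) = (\<Sum>x\<in>S. \<Sum>y\<in>U - S. adj E x y)"
    by (subst sum.swap) (simp add: insert_commute)
  also have "(\<Sum>x\<in>S. \<Sum>y\<in>S. adj E x y) = 2 * real (card (edges_in E S))"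
    using assms by (intro handshake[OF assms(1)]) auto
  also have "(\<Sum>x\<in>U - S. \<Sum>y\<in>U - S. adj E x y) = 2 * real (card (edges_in E (U - S)))"
    using assms by (intro handshake[OF assms(1)]) auto
  finally show ?thesis
    by linarith
qed

text \<open>The logarithm rewards halving: if S spans at most half the edges, the potentials of S
  and U - S together exceed that of U by at least \<open>en S\<close> minus \<open>lam\<close> times
  the cut. Since only U has positive potential, the cut must pay for \<open>en S\<close>. Deleting a
  vertex likewise gains D and loses at most \<open>lam\<close> times its degree.\<close>

lemma exists_expander_subgraph:
  fixes V :: "'a set" and E :: "'a set set" and D L :: real
  defines "L \<equiv> log 2 (real (card E))"
  assumes G: "simple_graph V E" and L: "L > 0" and D: "D > 0" "D * real (card V) < real (card E) * L"
  obtains U where "U \<subseteq> V" "U \<noteq> {}" "\<And>x. x \<in> U \<Longrightarrow> D / (2 * L) \<le> (\<Sum>v\<in>U. adj (edges_in E U) x v)"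
    "weighted_graph.conductance_ge U (adj (edges_in E U)) (1 / (4 * L + 1))"
proof -
  define en where "en U = real (card (edges_in E U))" for U
  define \<Phi> where "\<Phi> U = en U * (2 * L - log 2 (en U)) - D * real (card U)" for U
  have finE: "finite E" and finV: "finite V"
    using finite_edges[OF G] G by (auto simp: simple_graph_def)
  have EV: "edges_in E V = E"
    using G by (auto simp: simple_graph_def edges_in_def)
  \<comment> \<open>For V the bracket equals L, so the assumption on D says exactly this.\<close>
  have "\<Phi> V > 0"
    using D(2) by (simp add: \<Phi>_def en_def EV L_def algebra_simps)
  then obtain U where U: "U \<subseteq> V" "\<Phi> U > 0"
    and minU: "\<And>W. W \<subseteq> V \<Longrightarrow> \<Phi> W > 0 \<Longrightarrow> card U \<le> card W"
    using ex_has_least_nat[of "\<lambda>W. W \<subseteq> V \<and> \<Phi> W > 0" V card] by auto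
  have finU: "finite U"
    using U finV finite_subset by blast
  have small: "\<Phi> W \<le> 0" if "W \<subset> U" for W
    using minU[of W] that U(1) psubset_card_mono[OF finU that] by (force simp: not_less)
  have "edges_in E {} = {}"
    using G by (auto simp: edges_in_def simple_graph_def)
  then have "U \<noteq> {}"
    using U(2) by (auto simp: \<Phi>_def en_def)
  have en0: "en W \<ge> 0" for W
    by (simp add: en_def)
  have en_le: "en W \<le> en U" if "W \<subseteq> U" for W
    unfolding en_def using that finE by (auto intro!: card_mono edges_in_mono simp: edges_in_def)
  \<comment> \<open>An edgeless set is covered by the default value 0 of the logarithm at 0.\<close>
  have log_nonneg: "log 2 (en W) \<ge> 0" for W
    unfolding en_def by (cases "card (edges_in E W) = 0") (auto simp: log_def)
  have log_mono: "en W * (2 * L - log 2 (en W)) \<ge> en W * (2 * L - log 2 (en U))" if "W \<subseteq> U" for W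
    using en0[of W] en_le[OF that]
    by (cases "en W = 0") (auto intro!: mult_left_mono)
  have adj_U: "adj (edges_in E U) x y = adj E x y" if "x \<in> U" "y \<in> U" for x y
    using that by (auto simp: edges_in_def)
  define lam where "lam = 2 * L - log 2 (en U)"
  have lam: "lam \<le> 2 * L"
    using log_nonneg by (simp add: lam_def)
  have deg: "D / (2 * L) \<le> (\<Sum>v\<in>U. adj (edges_in E U) x v)" if x: "x \<in> U" for x
  proof -
    have "(\<Sum>v\<in>U. adj (edges_in E U) x v) = (\<Sum>v\<in>U. adj E x v)"
      using x by (intro sum.cong refl adj_U) auto
    also have "\<dots> = adj E x x + (\<Sum>v\<in>U - {x}. adj E x v)"
      by (rule sum.remove[OF finU x])
    also have "adj E x x = 0"
      using G by (auto simp: simple_graph_def)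
    finally have dg: "(\<Sum>v\<in>U. adj (edges_in E U) x v) = (\<Sum>v\<in>U - {x}. adj E x v)"
      by simp
    define t where "t = (\<Sum>v\<in>U - {x}. adj E x v)"
    have t0: "t \<ge> 0"
      by (auto simp: t_def intro: sum_nonneg)
    have "edges_in E {x} = {}"
      using G by (auto simp: edges_in_def simple_graph_def subset_singleton_iff)
    then have en: "en U = en (U - {x}) + t"
      using edges_in_split[OF G U(1), of "{x}"] x by (simp add: en_def t_def)
    have "en (U - {x}) * lam \<le> D * real (card (U - {x}))"
    proof -
      have "U - {x} \<subset> U"
        using x by blast
      from small[OF this] log_mono[of "U - {x}"] show ?thesis
        unfolding \<Phi>_def lam_def by fastforce
    qed
    moreover have "real (card (U - {x})) = real (card U) - 1"
      using card.remove[OF finU x] by simp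
    moreover have "en U * lam > D * real (card U)"
      using U(2) by (simp add: \<Phi>_def lam_def)
    ultimately have "t * lam > D"
      by (simp add: en algebra_simps)
    then have "D \<le> t * (2 * L)"
      using mult_left_mono[OF lam t0] by linarith
    then show ?thesis
      using L unfolding dg t_def[symmetric] by (simp add: field_simps)
  qed
  have deg_pos: "(\<Sum>v\<in>U. adj (edges_in E U) x v) > 0" if "x \<in> U" for x
    using deg[OF that] D(1) L by (intro less_le_trans[OF _ deg[OF that]]) simp
  interpret weighted_graph U "adj (edges_in E U)"
    by unfold_locales (use finU deg_pos in \<open>auto simp: insert_commute\<close>)
  have vol: "vol S = 2 * en S + (\<Sum>x\<in>S. \<Sum>y\<in>U - S. adj E x y)" if "S \<subseteq> U" for S
  proof -
    have "vol S = (\<Sum>x\<in>S. \<Sum>y\<in>U. adj E x y)"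
      unfolding vol_def local.deg_def using that by (intro sum.cong refl adj_U) auto
    also have "\<dots> = (\<Sum>x\<in>S. \<Sum>y\<in>S. adj E x y) + (\<Sum>x\<in>S. \<Sum>y\<in>U - S. adj E x y)"
      unfolding sum.distrib[symmetric] sum.subset_diff[OF that finU]
      by (intro sum.cong refl) (rule add.commute)
    also have "(\<Sum>x\<in>S. \<Sum>y\<in>S. adj E x y) = 2 * en S"
      unfolding en_def using that U(1) by (intro handshake[OF G]) auto
    finally show ?thesis .
  qed
  have "conductance_ge (1 / (4 * L + 1))"
    unfolding conductance_ge_def
  proof (intro allI impI)
    fix S assume S: "S \<subseteq> U" "2 * vol S \<le> vol U"
    define t where "t = (\<Sum>x\<in>S. \<Sum>y\<in>U - S. adj E x y)"
    have t: "(\<Sum>x\<in>S. \<Sum>y\<in>U - S. adj (edges_in E U) x y) = t"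
      unfolding t_def using S by (intro sum.cong refl adj_U) auto
    have t0: "t \<ge> 0"
      by (auto simp: t_def intro: sum_nonneg)
    show "1 / (4 * L + 1) * vol S \<le> (\<Sum>x\<in>S. \<Sum>y\<in>U - S. adj (edges_in E U) x y)"
    proof (cases "S = {}")
      case True
      then show ?thesis
        by (simp add: vol_def)
    next
      case False
      have "S \<noteq> U"
        using S(2) vol_pos \<open>U \<noteq> {}\<close> by fastforce
      with S False have sub: "S \<subset> U" "U - S \<subset> U"
        by auto
      have volU: "vol U = 2 * en U"
        using vol[of U] by simp
      have volS: "vol S = 2 * en S + t"
        using vol[OF S(1)] by (simp add: t_def)
      have half: "2 * en S \<le> en U"
        using S(2) t0 by (simp add: volU volS)
      \<comment> \<open>Halving the number of edges raises the bracket by 1; this is the gain of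
        \<open>en S\<close>.\<close>
      have "en S * (lam + 1) \<le> en S * (2 * L - log 2 (en S))"
      proof (cases "en S = 0")
        case False
        with en0[of S] have "en S > 0"
          by simp
        with half have "log 2 (2 * en S) \<le> log 2 (en U)"
          by (subst log_le_cancel_iff) auto
        with \<open>en S > 0\<close> have "log 2 (en S) + 1 \<le> log 2 (en U)"
          by (simp add: log_mult)
        then show ?thesis
          using en0 by (intro mult_left_mono) (auto simp: lam_def)
      qed simp
      moreover have "en (U - S) * lam \<le> en (U - S) * (2 * L - log 2 (en (U - S)))"
        using log_mono[of "U - S"] by (auto simp: lam_def)
      moreover have "\<Phi> S \<le> 0" "\<Phi> (U - S) \<le> 0"
        using small sub by auto
      moreover have "D * real (card U) = D * real (card S) + D * real (card (U - S))"
        using S(1) finU by (simp add: card_Diff_subset finite_subset card_mono of_nat_diff right_diff_distrib)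
      moreover have "en U * lam > D * real (card U)"
        using U(2) by (simp add: \<Phi>_def lam_def)
      moreover have "en U * lam = en S * lam + en (U - S) * lam + t * lam"
        using edges_in_split[OF G U(1) S(1)] by (simp add: en_def t_def algebra_simps)
      ultimately have "en S < t * lam"
        by (simp add: \<Phi>_def algebra_simps)
      then have "en S \<le> t * (2 * L)"
        using mult_left_mono[OF lam t0] by linarith
      \<comment> \<open>The volume is twice the inner edges plus the cut, so
        \<open>en S \<le> t * (2 * L)\<close> produces the constant
        \<open>4 * L + 1\<close>.\<close>
      then have "vol S \<le> (4 * L + 1) * t"
        by (simp add: volS algebra_simps)
      then show ?thesis
        unfolding t using L by (simp add: field_simps)
    qed
  qed
  with deg U(1) \<open>U \<noteq> {}\<close> that show ?thesis
    by blast
qed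

subsection \<open>Greedy embedding\<close>

lemma internal_vertices_eq:
  assumes "is_path p" "hd p \<noteq> last p"
  shows "internal_vertices p = set p - {hd p, last p}"
proof -
  obtain a q where p: "p = a # q"
    using assms by (cases p) (auto simp: is_path_def)
  then obtain q' b where "q = q' @ [b]"
    using assms by (cases q rule: rev_cases) auto
  with p assms show ?thesis
    by (auto simp: internal_vertices_def is_path_def)
qed

lemma card_internal_vertices_le: "card (internal_vertices p) \<le> length p"
proof -
  have "card (internal_vertices p) \<le> length (butlast (tl p))"
    unfolding internal_vertices_def by (rule card_length)
  then show ?thesis
    by simp
qed

lemma card_UN_le_mult:
  assumes "finite I" "\<And>i. i \<in> I \<Longrightarrow> card (A i) \<le> l"
  shows "card (\<Union>i\<in>I. A i) \<le> card I * l"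
  using card_UN_le[OF assms(1), of A] sum_bounded_above[of I "\<lambda>i. card (A i)" l] assms(2) by simp

text \<open>Each new path must avoid the colours used so far, all other branch vertices and all
  earlier interiors. A path on at most l vertices uses up at most l of each kind, so s and t need
  only grow with \<open>card H * l\<close>.\<close>

lemma greedy_rainbow_paths:
  fixes c :: "'a set \<Rightarrow> 'c" and \<phi> :: "'b \<Rightarrow> 'a"
  assumes conn: "\<And>x y S T. x \<in> U - T \<Longrightarrow> y \<in> U - T \<Longrightarrow> finite S \<Longrightarrow> finite T \<Longrightarrow>
      card S \<le> s \<Longrightarrow> card T \<le> t \<Longrightarrow>
      \<exists>p. is_path p \<and> hd p = x \<and> last p = y \<and> set p \<subseteq> U - T \<and> path_edges p \<subseteq> F \<and>
        inj_on c (path_edges p) \<and> c ` path_edges p \<inter> S = {} \<and> length p \<le> l"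
    and W: "finite W" "inj_on \<phi> W" "\<phi> ` W \<subseteq> U"
    and "finite H" "H \<subseteq> complete_edges W" "card H * l \<le> s" "card W + card H * l \<le> t"
  shows "\<exists>P. (\<forall>e\<in>H. is_path (P e) \<and> {hd (P e), last (P e)} = \<phi> ` e \<and>
        internal_vertices (P e) \<inter> \<phi> ` W = {} \<and> length (P e) \<le> l \<and> set (P e) \<subseteq> U \<and> path_edges (P e) \<subseteq> F) \<and>
      (\<forall>e\<in>H. \<forall>f\<in>H. e \<noteq> f \<longrightarrow> internal_vertices (P e) \<inter> internal_vertices (P f) = {}) \<and>
      inj_on c (\<Union>e\<in>H. path_edges (P e))"
  using assms(5-)
proof (induction H rule: finite_induct)
  case (insert e H)
  have cardH: "card (insert e H) = Suc (card H)"
    using insert.hyps by simp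
  have "H \<subseteq> complete_edges W" "card H * l \<le> s" "card W + card H * l \<le> t"
    using insert.prems cardH by auto
  from insert.IH[OF this] obtain P where
    P: "\<forall>f\<in>H. is_path (P f) \<and> {hd (P f), last (P f)} = \<phi> ` f \<and>
        internal_vertices (P f) \<inter> \<phi> ` W = {} \<and> length (P f) \<le> l \<and> set (P f) \<subseteq> U \<and> path_edges (P f) \<subseteq> F"
    and disj: "\<forall>f\<in>H. \<forall>g\<in>H. f \<noteq> g \<longrightarrow> internal_vertices (P f) \<inter> internal_vertices (P g) = {}"
    and inj: "inj_on c (\<Union>f\<in>H. path_edges (P f))"
    by (elim exE conjE) (rule that)
  have "e \<subseteq> W" "card e = 2"
    using insert.prems by (auto simp: complete_edges_def)
  then obtain a b where ab: "e = {a, b}" "a \<noteq> b" "a \<in> W" "b \<in> W"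
    by (auto simp: card_2_iff)
  define x where "x = \<phi> a"
  define y where "y = \<phi> b"
  have xy: "x \<noteq> y" "x \<in> \<phi> ` W" "y \<in> \<phi> ` W"
    using ab W(2) by (auto simp: x_def y_def inj_on_eq_iff)
  define S where "S = c ` (\<Union>f\<in>H. path_edges (P f))"
  define T where "T = (\<phi> ` W - {x, y}) \<union> (\<Union>f\<in>H. internal_vertices (P f))"
  have fin: "finite S" "finite T"
    using insert.hyps W(1) by (auto simp: S_def T_def internal_vertices_def)
  have "card S \<le> card (\<Union>f\<in>H. path_edges (P f))"
    unfolding S_def using insert.hyps by (intro card_image_le) auto
  also have "\<dots> \<le> card H * l"
    using P by (intro card_UN_le_mult insert.hyps) (blast intro: le_trans[OF card_path_edges_le])
  finally have cardS: "card S \<le> s"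
    using insert.prems cardH by simp
  have "card T \<le> card (\<phi> ` W - {x, y}) + card (\<Union>f\<in>H. internal_vertices (P f))"
    unfolding T_def by (rule card_Un_le)
  also have "\<dots> \<le> card W + card H * l"
  proof (rule add_mono)
    show "card (\<phi> ` W - {x, y}) \<le> card W"
      using W(1) card_image_le[of W \<phi>] by (meson card_Diff1_le card_mono Diff_subset finite_imageI le_trans)
    show "card (\<Union>f\<in>H. internal_vertices (P f)) \<le> card H * l"
      using P by (intro card_UN_le_mult insert.hyps) (blast intro: le_trans[OF card_internal_vertices_le])
  qed
  finally have cardT: "card T \<le> t"
    using insert.prems cardH by simp
  \<comment> \<open>The ends were removed from the branch vertices in T, and earlier interiors
    contain no branch vertex.\<close>
  have xyT: "x \<in> U - T" "y \<in> U - T"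
  proof -
    have "internal_vertices (P f) \<inter> \<phi> ` W = {}" if "f \<in> H" for f
      using P that by blast
    then have "x \<notin> T" "y \<notin> T"
      using xy(2,3) unfolding T_def by blast+
    then show "x \<in> U - T" "y \<in> U - T"
      using xy(2,3) W(3) by auto
  qed
  obtain p where p: "is_path p" "hd p = x" "last p = y" "set p \<subseteq> U - T" "path_edges p \<subseteq> F"
      "inj_on c (path_edges p)" "c ` path_edges p \<inter> S = {}" "length p \<le> l"
    using conn[OF xyT fin cardS cardT] by blast
  have int_p: "internal_vertices p = set p - {x, y}"
    using internal_vertices_eq[OF p(1)] p xy by simp
  define P' where "P' = P(e := p)"
  have P': "P' e = p" "\<And>f. f \<in> H \<Longrightarrow> P' f = P f"
    using insert.hyps by (auto simp: P'_def)
  have int_W: "internal_vertices p \<inter> \<phi> ` W = {}"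
    using int_p p(4) by (auto simp: T_def)
  have int_H: "internal_vertices p \<inter> internal_vertices (P f) = {}" if "f \<in> H" for f
    using int_p p(4) that by (auto simp: T_def)
  have paths: "is_path (P' f) \<and> {hd (P' f), last (P' f)} = \<phi> ` f \<and>
        internal_vertices (P' f) \<inter> \<phi> ` W = {} \<and> length (P' f) \<le> l \<and> set (P' f) \<subseteq> U \<and> path_edges (P' f) \<subseteq> F"
    if "f \<in> insert e H" for f
  proof (cases "f = e")
    case True
    then show ?thesis
      using p int_W P'(1) by (auto simp: ab(1) x_def y_def)
  next
    case False
    then show ?thesis
      using that P P'(2) by auto
  qed
  have disj': "internal_vertices (P' f) \<inter> internal_vertices (P' g) = {}"
    if "f \<in> insert e H" "g \<in> insert e H" "f \<noteq> g" for f g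
    using that disj int_H P' by (metis Int_commute insert_iff)
  have "(\<Union>f\<in>insert e H. path_edges (P' f)) = path_edges p \<union> (\<Union>f\<in>H. path_edges (P f))"
    using P' by auto
  moreover have "inj_on c (path_edges p \<union> (\<Union>f\<in>H. path_edges (P f)))"
    unfolding inj_on_Un using p(6,7) inj by (auto simp: S_def)
  ultimately show ?case
    using paths disj' by (intro exI[of _ P']) (auto simp del: P'(1) simp: P'_def)
qed (simp add: inj_on_def)

lemma subdivision_of_paths:
  fixes c :: "'a set \<Rightarrow> 'c" and \<phi> :: "'b \<Rightarrow> 'a"
  assumes G: "simple_graph V E" and U: "U \<subseteq> V" and F: "F \<subseteq> E" and W: "finite W" "inj_on \<phi> W" "\<phi> ` W \<subseteq> U"
    and H: "finite H"
    and P: "\<And>e. e \<in> H \<Longrightarrow> is_path (P e) \<and> {hd (P e), last (P e)} = \<phi> ` e \<and>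
        internal_vertices (P e) \<inter> \<phi> ` W = {} \<and> length (P e) \<le> l \<and> set (P e) \<subseteq> U \<and> path_edges (P e) \<subseteq> F"
    and disj: "\<And>e f. e \<in> H \<Longrightarrow> f \<in> H \<Longrightarrow> e \<noteq> f \<Longrightarrow> internal_vertices (P e) \<inter> internal_vertices (P f) = {}"
    and inj: "inj_on c (\<Union>e\<in>H. path_edges (P e))" and t: "real l \<le> t"
  shows "\<exists>V' E'. subgraph_of V' E' V E \<and> rainbow c E' \<and> subdivision_at_most t W H V' E'"
proof (intro exI conjI)
  define V' where "V' = \<phi> ` W \<union> (\<Union>e\<in>H. set (P e))"
  define E' where "E' = (\<Union>e\<in>H. path_edges (P e))"
  show "rainbow c E'"
    using inj by (simp add: rainbow_def E'_def)
  have PU: "set (P e) \<subseteq> U" "path_edges (P e) \<subseteq> F" if "e \<in> H" for e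
    using P[OF that] by auto
  have "simple_graph V' E'"
    unfolding simple_graph_def
  proof (intro conjI ballI)
    show "finite V'"
      using W H by (auto simp: V'_def)
    fix e assume "e \<in> E'"
    then obtain f where f: "f \<in> H" "e \<in> path_edges (P f)"
      by (auto simp: E'_def)
    then show "card e = 2"
      using P card_path_edge by blast
    show "e \<subseteq> V'"
      using f path_edges_subset[OF f(2)] by (auto simp: V'_def)
  qed
  moreover have "V' \<subseteq> V"
    unfolding V'_def using PU(1) U W(3) by blast
  moreover have "E' \<subseteq> E"
    unfolding E'_def using PU(2) F by blast
  ultimately show "subgraph_of V' E' V E"
    by (simp add: subgraph_of_def)
  have "real (card (internal_vertices (P e))) \<le> t" if "e \<in> H" for e
  proof -
    have "card (internal_vertices (P e)) \<le> l"
      using P[OF that] card_internal_vertices_le[of "P e"] by linarith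
    with t show ?thesis
      by linarith
  qed
  then show "subdivision_at_most t W H V' E'"
    unfolding subdivision_at_most_def V'_def E'_def using W P disj by (intro exI[of _ \<phi>] exI[of _ P]) auto
qed

section \<open>Choice of parameters and the final embedding\<close>

lemma card_complete_edges_le: "finite W \<Longrightarrow> finite (complete_edges W) \<and> card (complete_edges W) \<le> (card W)\<^sup>2"
proof -
  assume W: "finite W"
  have "complete_edges W \<subseteq> (\<lambda>(a, b). {a, b}) ` (W \<times> W)"
    by (auto simp: complete_edges_def card_2_iff)
  moreover have "card ((\<lambda>(a, b). {a, b}) ` (W \<times> W)) \<le> (card W)\<^sup>2"
    using card_image_le[of "W \<times> W" "\<lambda>(a, b). {a, b}"] W by (simp add: card_cartesian_product power2_eq_square)
  ultimately show ?thesis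
    using W by (meson card_mono finite_SigmaI finite_imageI finite_subset le_trans)
qed

lemma (in weighted_graph) conductance_ge_mono:
  assumes "conductance_ge \<phi>" "\<psi> \<le> \<phi>"
  shows "conductance_ge \<psi>"
  unfolding conductance_ge_def
proof (intro allI impI)
  fix S assume S: "S \<subseteq> U" "2 * vol S \<le> vol U"
  have "\<psi> * vol S \<le> \<phi> * vol S"
    using assms(2) by (intro mult_right_mono) auto
  also have "\<dots> \<le> (\<Sum>x\<in>S. \<Sum>y\<in>U - S. A x y)"
    using assms(1) S by (auto simp: conductance_ge_def)
  finally show "\<psi> * vol S \<le> (\<Sum>x\<in>S. \<Sum>y\<in>U - S. A x y)" .
qed

text \<open>Each step contracts squared norms by \<open>1 - 1 / (324 * l\<^sup>2)\<close>, where 324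
  is 4 times 81. The stated k makes the total at most exp(-(2 + 4l)), below 2 to the power -(2 +
  4l), which is one over 4 times the square of the volume bound.\<close>

lemma (in weighted_graph) mixing_of_conductance:
  fixes l :: real
  assumes "conductance_ge (1 / (9 * l))" "l \<ge> 1" "real k \<ge> 324 * l\<^sup>2 * (2 + 4 * l)"
    and "vol U \<le> 2 powr (2 * l)" "\<And>x. x \<in> U \<Longrightarrow> deg x \<ge> 1" "U \<noteq> {}"
  shows "mixing k"
proof (rule mixingI[OF assms(1)])
  have vol: "vol U > 0"
    using assms(6) vol_pos by blast
  have sq: "(1 / (9 * l))\<^sup>2 / 4 = 1 / (324 * l\<^sup>2)"
    by (simp add: power_divide power_mult_distrib)
  have "324 * l\<^sup>2 \<ge> 1"
    using one_le_power[OF assms(2), of 2] by simp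
  then have le1: "1 / (324 * l\<^sup>2) \<le> 1"
    by (subst divide_le_eq_1_pos) linarith+
  have "(1 - 1 / (324 * l\<^sup>2)) ^ k \<le> exp (- (1 / (324 * l\<^sup>2))) ^ k"
    using exp_ge_add_one_self[of "- (1 / (324 * l\<^sup>2))"] le1 by (intro power_mono) auto
  also have "\<dots> = exp (- (real k / (324 * l\<^sup>2)))"
    by (simp add: exp_of_nat_mult[symmetric])
  also have "\<dots> \<le> exp (- (2 + 4 * l))"
    using assms(2,3) by (simp add: field_simps)
  also have "\<dots> = 1 / exp (2 + 4 * l)"
    by (simp only: exp_minus inverse_eq_divide)
  also have "\<dots> \<le> 1 / 2 powr (2 + 4 * l)"
  proof (intro divide_left_mono)
    have "(2 + 4 * l) * ln 2 \<le> (2 + 4 * l) * 1"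
      using assms(2) ln_2_less_1 by (intro mult_left_mono) auto
    then show "2 powr (2 + 4 * l) \<le> exp (2 + 4 * l)"
      by (simp add: powr_def)
  qed auto
  also have "2 powr (2 + 4 * l) = 4 * (2 powr (2 * l))\<^sup>2"
    by (simp add: powr_add[symmetric] power2_eq_square) (simp add: powr_add)
  also have "1 / (4 * (2 powr (2 * l))\<^sup>2) \<le> 1 / (4 * (vol U)\<^sup>2)"
    using vol assms(4) by (intro divide_left_mono mult_left_mono power_mono) auto
  finally show "(1 - (1 / (9 * l))\<^sup>2 / 4) ^ k \<le> 1 / (4 * (vol U)\<^sup>2)"
    unfolding sq .
  show "0 \<le> 1 / (9 * l)" "1 / (9 * l) \<le> 1"
    using assms(2) by auto
qed (use assms in auto)

lemma sum_adj_le: "(\<Sum>v\<in>U. adj F x v) \<le> real (card U)"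
  using sum_bounded_above[of U "adj F x" 1] by (simp add: of_bool_def)

lemma rainbow_subdivision:
  fixes V :: "'a set" and E :: "'a set set" and c :: "'a set \<Rightarrow> 'c"
  defines "l \<equiv> log 2 (real (card V))"
  assumes G: "simple_graph V E" and col: "proper_edge_colouring E c"
    and edges: "real (card E) \<ge> real (card V) * l ^ 60"
    and m: "m \<ge> 2" and l: "l \<ge> real m" "l \<ge> 6001"
  shows "\<exists>V' E'. subgraph_of V' E' V E \<and> rainbow c E' \<and>
    subdivision_at_most (l ^ 6) {..<m} (complete_edges {..<m}) V' E'"
proof -
  define n where "n = real (card V)"
  define M where "M = real (card E)"
  define L where "L = log 2 M"
  have finV: "finite V"
    using G by (simp add: simple_graph_def)
  have n0: "n > 0"
  proof (rule ccontr)
    assume "\<not> n > 0"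
    then have "l = 0"
      by (simp add: n_def l_def log_def)
    with l show False by simp
  qed
  have n_eq: "n = 2 powr l"
    using n0 by (simp add: l_def n_def)
  have l60: "l ^ 60 \<ge> 1"
    using l by (intro one_le_power) simp
  have "n * 1 \<le> n * l ^ 60"
    using n0 l60 by (intro mult_left_mono) auto
  then have M: "n \<le> M" "n * l ^ 60 \<le> M"
    using edges by (auto simp: n_def M_def)
  then have M0: "M > 0"
    using n0 by linarith
  have "(\<Sum>x\<in>V. \<Sum>y\<in>V. adj E x y) \<le> (\<Sum>x\<in>V. real (card V))"
    by (intro sum_mono sum_adj_le)
  also have "(\<Sum>x\<in>V. \<Sum>y\<in>V. adj E x y) = 2 * M"
  proof -
    have "edges_in E V = E"
      using G by (auto simp: edges_in_def simple_graph_def)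
    then show ?thesis
      using handshake[OF G, of V] by (simp add: M_def)
  qed
  finally have "M \<le> n * n"
    using M0 by (simp add: n_def)
  then have "L \<le> log 2 (n * n)"
    unfolding L_def using M0 n0 by (subst log_le_cancel_iff) auto
  then have L2: "L \<le> 2 * l"
    using n0 by (simp add: log_mult l_def n_def)
  have L1: "l \<le> L"
    unfolding L_def l_def using M M0 n0 by (subst log_le_cancel_iff) (auto simp: n_def)
  have L0: "L > 0"
    using L1 l by linarith
  \<comment> \<open>The half gives the strict inequality \<open>D * n < M * L\<close>. The factor L
    cancels in \<open>D / (2 * L)\<close>, leaving minimum degree \<open>l ^ 60 / 4\<close>.\<close>
  define D where "D = l ^ 60 * L / 2"
  have D0: "D > 0"
    unfolding D_def using l60 L0 by (intro divide_pos_pos mult_pos_pos) linarith+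
  have "n * l ^ 60 * L \<le> M * L"
    using M L0 by (intro mult_right_mono) auto
  moreover have "D * n = n * l ^ 60 * L / 2"
    by (simp add: D_def)
  moreover have "M * L > 0"
    using M0 L0 by simp
  ultimately have "D * n < M * L"
    by linarith
  then obtain U where U: "U \<subseteq> V" "U \<noteq> {}"
    and deg0: "\<And>x. x \<in> U \<Longrightarrow> D / (2 * L) \<le> (\<Sum>v\<in>U. adj (edges_in E U) x v)"
    and cond: "weighted_graph.conductance_ge U (adj (edges_in E U)) (1 / (4 * L + 1))"
    using exists_expander_subgraph[of V E D, OF G] L0 D0 by (auto simp: L_def M_def n_def)
  define F where "F = edges_in E U"
  define d where "d = l ^ 60 / 4"
  have d: "D / (2 * L) = d"
    using L0 by (simp add: D_def d_def)
  have deg: "d \<le> (\<Sum>v\<in>U. adj F x v)" if "x \<in> U" for x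
    using deg0[OF that] unfolding d F_def .
  have l11: "320 * l ^ 10 < l ^ 60"
  proof -
    have "320 * l ^ 10 < l * l ^ 10"
      using l by (intro mult_strict_right_mono) auto
    also have "\<dots> = l ^ 11"
      by (simp add: power_eq_if)
    also have "\<dots> \<le> l ^ 60"
      using l by (intro power_increasing) auto
    finally show ?thesis .
  qed
  have l10: "l ^ 10 \<ge> l"
    using l power_increasing[of 1 10 l] by simp
  have dl: "d \<ge> l"
    using l11 l10 l unfolding d_def by linarith
  then have d0: "d > 0"
    using l by linarith
  have FG: "simple_graph U F"
    unfolding F_def using G U(1) by (rule simple_graph_edges_in)
  have finU: "finite U"
    using FG by (simp add: simple_graph_def)
  have cardU: "real (card U) \<le> n"
    using U(1) finV by (simp add: n_def card_mono)
  interpret weighted_graph U "adj F"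
    using deg d0 by (intro weighted_graph_adj FG) (force intro: less_le_trans)
  define k where "k = nat \<lceil>324 * l\<^sup>2 * (2 + 4 * l)\<rceil>"
  have k_ge: "real k \<ge> 324 * l\<^sup>2 * (2 + 4 * l)"
    unfolding k_def by (rule real_nat_ceiling_ge)
  have mix: "mixing k"
  proof (rule mixing_of_conductance[where l = l])
    \<comment> \<open>There are at most n squared edges, so L is at most 2l; this fixes the constant
      9.\<close>
    have "4 * L + 1 \<le> 9 * l"
      using L2 l by linarith
    then have "1 / (9 * l) \<le> 1 / (4 * L + 1)"
      using L0 l by (intro divide_left_mono) auto
    then show "conductance_ge (1 / (9 * l))"
      using cond conductance_ge_mono unfolding F_def by blast
    have "vol U \<le> real (card U) * real (card U)"
      using sum_bounded_above[of U deg "real (card U)"] sum_adj_le[where F = F and U = U]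
      by (simp add: vol_def local.deg_def)
    also have "\<dots> \<le> n * n"
      using cardU by (intro mult_mono) auto
    also have "\<dots> = 2 powr (2 * l)"
      by (simp add: n_eq powr_add[symmetric])
    finally show "vol U \<le> 2 powr (2 * l)" .
    show "1 \<le> deg x" if "x \<in> U" for x
      using deg[OF that] dl l unfolding local.deg_def by linarith
  qed (use k_ge l U in auto)
  define q where "q = 3 * k + 1"
  have q4: "real q \<le> l ^ 4"
  proof -
    have "real k \<le> 324 * l\<^sup>2 * (2 + 4 * l) + 1"
    proof -
      have "0 \<le> 324 * l\<^sup>2 * (2 + 4 * l)"
        using l by simp
      then have "real k = of_int \<lceil>324 * l\<^sup>2 * (2 + 4 * l)\<rceil>"
        unfolding k_def by (intro of_nat_nat) linarith
      then show ?thesis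
        by (simp only: of_int_ceiling_le_add_one)
    qed
    moreover have "324 * l\<^sup>2 * (2 + 4 * l) = 648 * l\<^sup>2 + 1296 * l ^ 3"
      by (simp add: algebra_simps power_eq_if)
    moreover have "l\<^sup>2 \<le> l ^ 3" "1 \<le> l ^ 3"
      using l by (auto intro: power_increasing one_le_power)
    \<comment> \<open>The sum is at most 3(648 + 1296 + 1) + 1 = 5836 times \<open>l ^ 3\<close>;
      the threshold 6001 on l absorbs it.\<close>
    ultimately have "real q \<le> 6001 * l ^ 3"
      by (simp add: q_def)
    also have "\<dots> \<le> l * l ^ 3"
      using l by (intro mult_right_mono) auto
    also have "\<dots> = l ^ 4"
      by (simp add: power_eq_if)
    finally show ?thesis .
  qed
  have H: "finite (complete_edges {..<m})" "card (complete_edges {..<m}) \<le> m\<^sup>2"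
    using card_complete_edges_le[of "{..<m}"] by auto
  have small: "18 * (real k)\<^sup>2 + 6 * real k * real a + 8 * real k * real b < d / 2"
    if "a \<le> m\<^sup>2 * q" "b \<le> m + m\<^sup>2 * q" for a b
  proof -
    have m1: "1 \<le> m\<^sup>2" "m \<le> m\<^sup>2 * q"
      using m by (auto simp: power2_eq_square q_def intro: trans_le_add1)
    have b: "b \<le> 2 * (m\<^sup>2 * q)"
      using that m1 by linarith
    \<comment> \<open>The coefficients add up to 18 + 6 + 16 = 40. With m at most l and q at most
      \<open>l ^ 4\<close> the total is at most \<open>40 * l ^ 10\<close>, to be compared with
      \<open>d / 2 = l ^ 60 / 8\<close>.\<close>
    have "18 * k\<^sup>2 + 6 * k * a + 8 * k * b \<le> 18 * (1 * q\<^sup>2) + 6 * q * (m\<^sup>2 * q) + 8 * q * (2 * (m\<^sup>2 * q))"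
      using that b by (intro add_mono mult_mono power_mono) (auto simp: q_def)
    also have "\<dots> \<le> 18 * (m\<^sup>2 * q\<^sup>2) + 6 * q * (m\<^sup>2 * q) + 8 * q * (2 * (m\<^sup>2 * q))"
      using m1 by (intro add_mono mult_mono) auto
    also have "\<dots> = 40 * (m\<^sup>2 * q\<^sup>2)"
      by (simp add: power2_eq_square)
    finally have "real (18 * k\<^sup>2 + 6 * k * a + 8 * k * b) \<le> real (40 * (m\<^sup>2 * q\<^sup>2))"
      by (simp only: of_nat_le_iff)
    then have "18 * (real k)\<^sup>2 + 6 * real k * real a + 8 * real k * real b \<le> 40 * ((real m)\<^sup>2 * (real q)\<^sup>2)"
      by simp
    also have "\<dots> \<le> 40 * (l\<^sup>2 * (l ^ 4)\<^sup>2)"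
      using l q4 by (intro mult_left_mono mult_mono power_mono) auto
    also have "\<dots> = 40 * l ^ 10"
      by (simp add: power_add[symmetric] power_mult[symmetric])
    also have "\<dots> < d / 2"
      using l11 by (simp add: d_def)
    finally show ?thesis .
  qed
  have colF: "proper_edge_colouring F c"
    using col by (auto simp: proper_edge_colouring_def F_def edges_in_def)
  have conn: "\<exists>p. is_path p \<and> hd p = x \<and> last p = y \<and> set p \<subseteq> U - T \<and> path_edges p \<subseteq> F \<and>
        inj_on c (path_edges p) \<and> c ` path_edges p \<inter> S = {} \<and> length p \<le> q"
    if "x \<in> U - T" "y \<in> U - T" "finite S" "finite T" "card S \<le> m\<^sup>2 * q" "card T \<le> m + m\<^sup>2 * q" for x y S T
    unfolding q_def using that deg d0 mix small[of "card S" "card T"]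
    by (intro rainbow_path_avoiding[OF FG colF, of d]) auto
  obtain x where "x \<in> U"
    using U by blast
  have "real m \<le> real (card U)"
    using deg[OF \<open>x \<in> U\<close>] sum_adj_le[where F = F and x = x and U = U] dl l by linarith
  then obtain \<phi> where \<phi>: "\<phi> ` {..<m} \<subseteq> U" "inj_on \<phi> {..<m}"
    using card_le_inj[of "{..<m}" U] finU by auto
  have cardH: "card (complete_edges {..<m}) * q \<le> m\<^sup>2 * q"
    using H by (intro mult_right_mono) auto
  then have cardH': "card {..<m} + card (complete_edges {..<m}) * q \<le> m + m\<^sup>2 * q"
    by simp
  obtain P where
    P: "\<forall>e\<in>complete_edges {..<m}. is_path (P e) \<and> {hd (P e), last (P e)} = \<phi> ` e \<and>
      internal_vertices (P e) \<inter> \<phi> ` {..<m} = {} \<and> length (P e) \<le> q \<and> set (P e) \<subseteq> U \<and> path_edges (P e) \<subseteq> F"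
    "\<forall>e\<in>complete_edges {..<m}. \<forall>f\<in>complete_edges {..<m}. e \<noteq> f \<longrightarrow>
      internal_vertices (P e) \<inter> internal_vertices (P f) = {}"
    "inj_on c (\<Union>e\<in>complete_edges {..<m}. path_edges (P e))"
    by (rule exE[OF greedy_rainbow_paths[OF _ finite_lessThan \<phi>(2,1) H(1) order_refl cardH cardH']],
        rule conn, assumption+, elim conjE, rule that)
  show ?thesis
  proof (rule subdivision_of_paths[OF G U(1) _ finite_lessThan \<phi>(2,1) H(1)])
    show "F \<subseteq> E"
      by (auto simp: F_def edges_in_def)
    have "l ^ 4 \<le> l ^ 6"
      using l by (intro power_increasing) auto
    then show "real q \<le> l ^ 6"
      using q4 by linarith
  qed (use P in auto)
qed

theorem theorem2:
  fixes m :: nat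
  assumes "m \<ge> 2"
  shows "\<exists>N::nat. \<forall>n\<ge>N. \<forall>(V :: 'a set) (E :: 'a set set) (c :: 'a set \<Rightarrow> 'c).
    simple_graph V E \<and> card V = n \<and> proper_edge_colouring E c \<and>
    real (card E) \<ge> real n * (log 2 (real n)) ^ 60 \<longrightarrow>
    (\<exists>V' E'. subgraph_of V' E' V E \<and> rainbow c E' \<and>
       subdivision_at_most ((log 2 (real n)) ^ 6) {..<m} (complete_edges {..<m}) V' E')"
proof -
  \<comment> \<open>For n at least 2 to the q, the logarithm exceeds both thresholds, m and
    6001.\<close>
  define q where "q = m + 6001"
  have "log 2 (real n) \<ge> real q" if "n \<ge> 2 ^ q" for n :: nat
  proof -
    have "real (2 ^ q) \<le> real n"
      using that by (simp only: of_nat_le_iff)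
    then show ?thesis
      by (intro le_log_of_power) simp_all
  qed
  then have "log 2 (real n) \<ge> real m" "log 2 (real n) \<ge> 6001" if "n \<ge> 2 ^ q" for n :: nat
    using that by (force simp: q_def)+
  with assms show ?thesis
    by (intro exI[of _ "2 ^ q"] allI impI) (auto intro!: rainbow_subdivision)
qed

end
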